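(* Let $R$ be a finite valuation ring with residue field of odd size $q$ and with uniformizer of nilpotency degree $\ell$. For $n\geq 2$, the set of adjacency eigenvalues of $\mathrm{Um}(R^n)$ consists of $\pm q^{(n-1)\ell}$, $\pm q^{(n-1)\ell-n/2}$, $\pm q^{(n-1)(\ell-k/2)}$ for $k=1,\dots,\ell$, together with $0$ in the case when $R$ is not a field. For $n\geq 3$, the set of adjacency eigenvalues of $\mathrm{Um}_0(R^n)$ consists of $\pm q^{(n-2)(\ell-1)}(q^{n-1}-1)/(q-1)$ and $\pm q^{(n-2)(\ell-k/2)}$ for $k=1,\dots,\ell$.
   Context: Rings are commutative with identity. A finite valuation ring is a finite local principal ring; its maximal ideal is $(\pi)$, $q=|R/(\pi)|$, and $\ell$ is the smallest positive integer with $\pi^\ell=0$. $R^{n,u}$ is the set of $n$-tuples whose entries generate $R$ as an ideal; $R^\times$ is the unit group. Dot product: $a\cdot b=\sum_i a_ib_i$. $\mathrm{Um}(R^n)$ ($n\geq2$) is the bipartite graph on two copies $\{a_\bullet\},\{b_\circ\}$ of $R^{n,u}$ with $a_\bullet\sim b_\circ$ iff $a\cdot b=1$; $\mathrm{Um}_0(R^n)$ ($n\geq3$) is the bipartite graph on two copies of $R^{n,u}/R^\times$ with $[a]_\bullet\sim[b]_\circ$ iff $a\cdot b=0$. *)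

theory Defs
  imports
    "Jordan_Normal_Form.Char_Poly"
    "Graph_Theory.Pair_Digraph"
    "HOL.Hull"
    Complex_Main
begin

definition (in comm_ring_1) is_ideal :: "'a set \<Rightarrow> bool" where
  "is_ideal I \<longleftrightarrow> 0 \<in> I \<and> (\<forall>x\<in>I. \<forall>y\<in>I. x + y \<in> I) \<and> (\<forall>r. \<forall>x\<in>I. r * x \<in> I)"

definition (in comm_ring_1) is_maximal_ideal :: "'a set \<Rightarrow> bool" where
  "is_maximal_ideal M \<longleftrightarrow>
     is_ideal M \<and> M \<noteq> UNIV \<and> (\<forall>J. is_ideal J \<and> M \<subseteq> J \<longrightarrow> J = M \<or> J = UNIV)"

abbreviation (in comm_ring_1) ideal_generated :: "'a set \<Rightarrow> 'a set" where
  "ideal_generated S \<equiv> is_ideal hull S"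

class finite_valuation_ring = comm_ring_1 + finite +
  assumes local_ring: "\<exists>!M. is_maximal_ideal M"
    and principal_ring: "is_ideal I \<Longrightarrow> \<exists>x. I = ideal_generated {x}"

definition quotient_ring_card :: "'a::comm_ring_1 set \<Rightarrow> nat" where
  "quotient_ring_card I = card (UNIV // {(x, y). x - y \<in> I})"

definition unimodular_vecs :: "nat \<Rightarrow> 'a::comm_ring_1 vec set" where
  "unimodular_vecs n = {a \<in> carrier_vec n. ideal_generated (set\<^sub>v a) = UNIV}"

definition unit_scaling :: "nat \<Rightarrow> 'a::comm_ring_1 vec rel" where
  "unit_scaling n =
     {(a, b). a \<in> unimodular_vecs n \<and> b \<in> unimodular_vecs n \<and> (\<exists>u. u dvd 1 \<and> b = u \<cdot>\<^sub>v a)}"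

text \<open>Undirected graphs are symmetric pair digraphs.  The summands of the vertex type
  are the two colour classes: \<^term>\<open>Inl a\<close> is the vertex of \<open>a\<close> marked by a bullet,
  \<^term>\<open>Inr b\<close> the vertex of \<open>b\<close> marked by a circle.\<close>

definition bipartite_graph :: "'v set \<Rightarrow> 'w set \<Rightarrow> ('v \<Rightarrow> 'w \<Rightarrow> bool) \<Rightarrow> ('v + 'w) pair_pre_digraph" where
  "bipartite_graph X Y E =
     (let A = {(Inl x, Inr y) | x y. x \<in> X \<and> y \<in> Y \<and> E x y}
      in \<lparr>pverts = X <+> Y, parcs = A \<union> A\<inverse>\<rparr>)"

definition Um :: "nat \<Rightarrow> ('a::comm_ring_1 vec + 'a vec) pair_pre_digraph" where
  "Um n = bipartite_graph (unimodular_vecs n) (unimodular_vecs n) (\<lambda>a b. a \<bullet> b = 1)"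

text \<open>Orthogonality is invariant under scaling by units, so it does not depend on the
  chosen representatives.\<close>

definition Um0 :: "nat \<Rightarrow> ('a::comm_ring_1 vec set + 'a vec set) pair_pre_digraph" where
  "Um0 n = bipartite_graph (unimodular_vecs n // unit_scaling n) (unimodular_vecs n // unit_scaling n)
     (\<lambda>A B. \<exists>a\<in>A. \<exists>b\<in>B. a \<bullet> b = 0)"

definition adjacency_matrix :: "'v pair_pre_digraph \<Rightarrow> 'v list \<Rightarrow> complex mat" where
  "adjacency_matrix G vs =
     mat (length vs) (length vs) (\<lambda>(i, j). if (vs ! i, vs ! j) \<in> parcs G then 1 else 0)"

text \<open>The order \<open>vs\<close> in which the vertices are listed is immaterial: a different order
  conjugates the adjacency matrix by a permutation matrix.\<close>

definition adjacency_eigenvalues :: "'v pair_pre_digraph \<Rightarrow> complex set" where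
  "adjacency_eigenvalues G =
     {\<mu>. \<exists>vs. distinct vs \<and> set vs = pverts G \<and> eigenvalue (adjacency_matrix G vs) \<mu>}"

definition plus_minus :: "real set \<Rightarrow> complex set" where
  "plus_minus S = complex_of_real ` (S \<union> uminus ` S)"

end

theory Submission
  imports Defs
begin

text \<open>The dot product is symmetric, so \<open>\<mu>\<close> is an eigenvalue of either bipartite graph iff \<open>\<mu>\<^sup>2\<close> is
  an eigenvalue of the kernel that counts the common neighbours of two vertices.  That count
  depends only on the largest \<open>j\<close> such that \<open>a\<close> and \<open>b\<close> are proportional modulo \<open>\<pi>\<^sup>j\<close> and, for
  \<open>Um\<close>, on whether they are then congruent modulo \<open>\<pi>\<^sup>j\<close>.  The kernel is therefore a linear
  combination of the indicators of a decreasing chain of equivalence relations whose classes have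
  constant size: proportionality modulo \<open>\<pi>\<^sup>j\<close> for \<open>Um0\<close>; for \<open>Um\<close>, congruence modulo \<open>\<pi>\<^sup>j\<close>
  alternating with the conjunction of congruence modulo \<open>\<pi>\<^sup>j\<close> and proportionality modulo
  \<open>\<pi>\<^sup>j\<^sup>+\<^sup>1\<close>.  Such a kernel is diagonalised by the functions that are constant on the classes of
  one relation and have sum zero on the classes of the next coarser one.\<close>

section \<open>Spectra of bipartite graphs and of kernels on a chain of equivalence relations\<close>

text \<open>Write \<open>b = u a + \<pi>^j c\<close> with \<open>j <= l\<close> maximal. The pair of
  dot products of x with a and b then takes q^l q^(l-j) values, each equally often, which is why the
  counts see only \<open>j\<close>. For Um the value (1,1) is among them exactly if \<open>u\<close>
  is 1 modulo \<pi>^j. So the count is carried by pairs congruent modulo \<pi>^j but not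
  proportional modulo \<pi>^(j+1); this indicator is a difference of two relations, hence the
  alternating chain and alternating signs. The eigenvalue at an index is the tail sum of coefficient
  times class size. For Um the tails at 2k+1 with 0 < k < l cancel completely, which gives the
  eigenvalue 0 when l > 1. The tail at 1 does not: modulo \<pi> the admissible multipliers are the
  q-1 nonzero residues, whereas for k > 0 each multiplier that is 1 modulo \<pi>^k has q lifts
  modulo \<pi>^(k+1). The surplus is the isolated value q^((n-1)l-n/2) after taking roots. An index
  contributes an eigenvalue because its relation properly refines the previous one, so every proof
  about a chain includes the strict change of class sizes.\<close>

definition kernel_eigenvalue :: "'x set \<Rightarrow> ('x \<Rightarrow> 'x \<Rightarrow> complex) \<Rightarrow> complex \<Rightarrow> bool" where
  "kernel_eigenvalue X K \<mu> \<longleftrightarrow>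
     (\<exists>h. (\<exists>x\<in>X. h x \<noteq> 0) \<and> (\<forall>x\<in>X. (\<Sum>y\<in>X. K x y * h y) = \<mu> * h x))"

lemma adjacency_matrix_mult_index:
  assumes "distinct vs" "i < length vs" "dim_vec v = length vs"
  shows "(adjacency_matrix G vs *\<^sub>v v) $ i =
    (\<Sum>j<length vs. if (vs ! i, vs ! j) \<in> parcs G then v $ j else 0)"
  using assms
  by (auto simp: adjacency_matrix_def scalar_prod_def atLeast0LessThan intro!: sum.cong)

lemma adjacency_eigenvalues_iff:
  assumes fin: "finite (pverts G)"
  shows "\<mu> \<in> adjacency_eigenvalues G \<longleftrightarrow>
    (\<exists>f. (\<exists>v\<in>pverts G. f v \<noteq> 0) \<and>
       (\<forall>v\<in>pverts G. (\<Sum>w | w \<in> pverts G \<and> (v, w) \<in> parcs G. f w) = \<mu> * f v))"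
    (is "_ \<longleftrightarrow> ?R")
proof
  assume "\<mu> \<in> adjacency_eigenvalues G"
  then obtain vs v where vs: "distinct vs" "set vs = pverts G"
    and ev: "eigenvector (adjacency_matrix G vs) v \<mu>"
    unfolding adjacency_eigenvalues_def eigenvalue_def by auto
  have dim: "dim_row (adjacency_matrix G vs) = length vs"
    by (simp add: adjacency_matrix_def)
  from ev have v: "dim_vec v = length vs" "v \<noteq> 0\<^sub>v (length vs)"
    and eq: "adjacency_matrix G vs *\<^sub>v v = \<mu> \<cdot>\<^sub>v v"
    unfolding eigenvector_def dim by auto
  have bij: "bij_betw ((!) vs) {..<length vs} (pverts G)"
    using bij_betw_nth[OF vs(1) refl] vs(2) by simp
  define g where "g = the_inv_into {..<length vs} ((!) vs)"
  have g: "g (vs ! i) = i" if "i < length vs" for i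
    unfolding g_def using that bij by (simp add: bij_betw_def the_inv_into_f_f)
  define f where "f w = v $ g w" for w
  have "\<exists>i<length vs. v $ i \<noteq> 0"
  proof (rule ccontr)
    assume "\<not> ?thesis"
    then have "v = 0\<^sub>v (length vs)" using v(1) by (intro eq_vecI) auto
    with v(2) show False ..
  qed
  then obtain i where i: "i < length vs" "v $ i \<noteq> 0" by auto
  have "\<exists>w\<in>pverts G. f w \<noteq> 0"
    using i g[OF i(1)] nth_mem[OF i(1)] unfolding vs(2) f_def by metis
  moreover have "(\<Sum>w | w \<in> pverts G \<and> (u, w) \<in> parcs G. f w) = \<mu> * f u"
    if u: "u \<in> pverts G" for u
  proof -
    obtain i where i: "i < length vs" "u = vs ! i"
      using u vs(2) by (metis in_set_conv_nth)
    have "(\<Sum>w | w \<in> pverts G \<and> (u, w) \<in> parcs G. f w) =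
        (\<Sum>w\<in>pverts G. if (u, w) \<in> parcs G then f w else 0)"
      using fin by (simp add: sum.inter_filter)
    also have "\<dots> = (\<Sum>j<length vs. if (u, vs ! j) \<in> parcs G then f (vs ! j) else 0)"
      by (rule sum.reindex_bij_betw[OF bij, symmetric])
    also have "\<dots> = (\<Sum>j<length vs. if (vs ! i, vs ! j) \<in> parcs G then v $ j else 0)"
      using i g by (intro sum.cong) (auto simp: f_def)
    also have "\<dots> = (adjacency_matrix G vs *\<^sub>v v) $ i"
      using adjacency_matrix_mult_index[OF vs(1) i(1) v(1)] by simp
    also have "\<dots> = \<mu> * f u"
      using eq i v g by (simp add: f_def)
    finally show ?thesis .
  qed
  ultimately show ?R by blast
next
  assume ?R
  then obtain f where nz: "\<exists>v\<in>pverts G. f v \<noteq> 0"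
    and ev: "\<And>v. v \<in> pverts G \<Longrightarrow> (\<Sum>w | w \<in> pverts G \<and> (v, w) \<in> parcs G. f w) = \<mu> * f v"
    by blast
  obtain vs where vs: "set vs = pverts G" "distinct vs"
    using finite_distinct_list[OF fin] by blast
  have bij: "bij_betw ((!) vs) {..<length vs} (pverts G)"
    using bij_betw_nth[OF vs(2) refl] vs(1) by simp
  define v where "v = vec (length vs) (\<lambda>i. f (vs ! i))"
  have dim: "dim_row (adjacency_matrix G vs) = length vs"
    by (simp add: adjacency_matrix_def)
  have "v \<noteq> 0\<^sub>v (length vs)"
  proof -
    obtain i where "i < length vs" "f (vs ! i) \<noteq> 0"
      using nz vs(1) by (metis in_set_conv_nth)
    then show ?thesis unfolding v_def by (metis index_vec index_zero_vec(1))
  qed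
  moreover have "adjacency_matrix G vs *\<^sub>v v = \<mu> \<cdot>\<^sub>v v"
  proof (rule eq_vecI)
    fix i assume "i < dim_vec (\<mu> \<cdot>\<^sub>v v)"
    then have i: "i < length vs" by (simp add: v_def)
    have "(adjacency_matrix G vs *\<^sub>v v) $ i =
        (\<Sum>j<length vs. if (vs ! i, vs ! j) \<in> parcs G then v $ j else 0)"
      using adjacency_matrix_mult_index[OF vs(2) i, of v G] by (simp add: v_def)
    also have "\<dots> = (\<Sum>j<length vs. if (vs ! i, vs ! j) \<in> parcs G then f (vs ! j) else 0)"
      by (intro sum.cong) (auto simp: v_def)
    also have "\<dots> = (\<Sum>w\<in>pverts G. if (vs ! i, w) \<in> parcs G then f w else 0)"
      by (rule sum.reindex_bij_betw[OF bij])
    also have "\<dots> = (\<Sum>w | w \<in> pverts G \<and> (vs ! i, w) \<in> parcs G. f w)"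
      using fin by (simp add: sum.inter_filter)
    also have "\<dots> = \<mu> * f (vs ! i)"
      using ev nth_mem[OF i] unfolding vs(1) by blast
    finally show "(adjacency_matrix G vs *\<^sub>v v) $ i = (\<mu> \<cdot>\<^sub>v v) $ i"
      using i by (simp add: v_def)
  qed (simp_all add: v_def adjacency_matrix_def)
  ultimately have "eigenvector (adjacency_matrix G vs) v \<mu>"
    unfolding eigenvector_def dim by (simp add: v_def)
  then show "\<mu> \<in> adjacency_eigenvalues G"
    using vs unfolding adjacency_eigenvalues_def eigenvalue_def by blast
qed

text \<open>Since \<open>E\<close> is symmetric, both off-diagonal blocks are one operator
  \<open>N\<close>, and an eigenvector is a pair with \<open>N h = \<mu> g\<close> and
  \<open>N g = \<mu> h\<close>. Squaring decouples the pair, and the kernel of \<open>N N\<close>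
  counts common neighbours.\<close>

lemma bipartite_graph_eigenvalues_iff:
  assumes fin: "finite X" and sym: "\<And>x y. x \<in> X \<Longrightarrow> y \<in> X \<Longrightarrow> E x y = E y x"
  shows "\<mu> \<in> adjacency_eigenvalues (bipartite_graph X X E) \<longleftrightarrow>
    kernel_eigenvalue X (\<lambda>x y. of_nat (card {z\<in>X. E x z \<and> E y z})) (\<mu>\<^sup>2)"
proof -
  let ?G = "bipartite_graph X X E"
  define N where "N h x = (\<Sum>y | y \<in> X \<and> E x y. h y)" for h :: "'a \<Rightarrow> complex" and x
  have N_scale: "N (\<lambda>x. c * h x) x = c * N h x" for c h x
    by (simp add: N_def sum_distrib_left)
  have N_cong: "N h x = N h' x" if "\<And>y. y \<in> X \<Longrightarrow> h y = h' y" for h h' x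
    unfolding N_def using that by (intro sum.cong) auto
  have NN: "N (N h) x = (\<Sum>y\<in>X. of_nat (card {z\<in>X. E x z \<and> E y z}) * h y)" if x: "x \<in> X" for h x
  proof -
    have "N (N h) x = (\<Sum>z\<in>X. \<Sum>y\<in>X. if E x z \<and> E z y then h y else 0)"
      unfolding N_def sum.inter_filter[OF fin] by (intro sum.cong) auto
    also have "\<dots> = (\<Sum>y\<in>X. \<Sum>z\<in>X. if E x z \<and> E y z then h y else 0)"
      using sym by (subst sum.swap) (intro sum.cong; auto)
    also have "\<dots> = (\<Sum>y\<in>X. of_nat (card {z\<in>X. E x z \<and> E y z}) * h y)"
      using fin by (intro sum.cong) (auto simp: sum.inter_filter[symmetric])
    finally show ?thesis .
  qed
  have verts: "pverts ?G = X <+> X"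
    by (simp add: bipartite_graph_def Let_def)
  have out_l: "{w. w \<in> pverts ?G \<and> (Inl x, w) \<in> parcs ?G} = Inr ` {y. y \<in> X \<and> E x y}"
    if "x \<in> X" for x
    using that by (auto simp: bipartite_graph_def Let_def)
  have out_r: "{w. w \<in> pverts ?G \<and> (Inr x, w) \<in> parcs ?G} = Inl ` {y. y \<in> X \<and> E x y}"
    if "x \<in> X" for x
    using that sym by (auto simp: bipartite_graph_def Let_def)
  have sum_l: "(\<Sum>w | w \<in> pverts ?G \<and> (Inl x, w) \<in> parcs ?G. f w) = N (\<lambda>y. f (Inr y)) x"
    if "x \<in> X" for x and f :: "'a + 'a \<Rightarrow> complex"
    unfolding out_l[OF that] N_def by (subst sum.reindex) (auto simp: inj_on_def)
  have sum_r: "(\<Sum>w | w \<in> pverts ?G \<and> (Inr x, w) \<in> parcs ?G. f w) = N (\<lambda>y. f (Inl y)) x"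
    if "x \<in> X" for x and f :: "'a + 'a \<Rightarrow> complex"
    unfolding out_r[OF that] N_def by (subst sum.reindex) (auto simp: inj_on_def)
  have pairs: "\<mu> \<in> adjacency_eigenvalues ?G \<longleftrightarrow>
    (\<exists>g h. (\<exists>x\<in>X. g x \<noteq> 0 \<or> h x \<noteq> 0) \<and> (\<forall>x\<in>X. N h x = \<mu> * g x \<and> N g x = \<mu> * h x))"
    (is "?L \<longleftrightarrow> ?P")
  proof
    assume ?L
    then obtain f where f: "\<exists>v\<in>X <+> X. f v \<noteq> 0" "\<forall>v\<in>X <+> X.
        (\<Sum>w | w \<in> pverts ?G \<and> (v, w) \<in> parcs ?G. f w) = \<mu> * f v"
      using adjacency_eigenvalues_iff[of ?G \<mu>] fin unfolding verts by auto
    have "N (\<lambda>y. f (Inr y)) x = \<mu> * f (Inl x)" "N (\<lambda>y. f (Inl y)) x = \<mu> * f (Inr x)"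
      if "x \<in> X" for x
      using f(2)[rule_format, OF InlI[OF that]] f(2)[rule_format, OF InrI[OF that]]
      unfolding sum_l[OF that] sum_r[OF that] by simp_all
    with f(1) show ?P
      by (intro exI[of _ "\<lambda>x. f (Inl x)"] exI[of _ "\<lambda>x. f (Inr x)"]) auto
  next
    assume ?P
    then obtain g h where gh: "\<exists>x\<in>X. g x \<noteq> 0 \<or> h x \<noteq> 0"
      "\<And>x. x \<in> X \<Longrightarrow> N h x = \<mu> * g x" "\<And>x. x \<in> X \<Longrightarrow> N g x = \<mu> * h x" by blast
    define f where "f = case_sum g h"
    have "\<exists>v\<in>X <+> X. f v \<noteq> 0"
      using gh(1) by (force simp: f_def)
    moreover have "(\<Sum>w | w \<in> pverts ?G \<and> (v, w) \<in> parcs ?G. f w) = \<mu> * f v" if "v \<in> X <+> X" for v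
      using that
    proof (rule PlusE)
      fix x assume "x \<in> X" "v = Inl x"
      then show ?thesis using sum_l[of x f] gh(2) by (simp add: f_def)
    next
      fix x assume "x \<in> X" "v = Inr x"
      then show ?thesis using sum_r[of x f] gh(3) by (simp add: f_def)
    qed
    ultimately show ?L
      using adjacency_eigenvalues_iff[of ?G \<mu>] fin unfolding verts by auto
  qed
  have "?P \<longleftrightarrow> (\<exists>h. (\<exists>x\<in>X. h x \<noteq> 0) \<and> (\<forall>x\<in>X. N (N h) x = \<mu>\<^sup>2 * h x))" (is "_ \<longleftrightarrow> ?Q")
  proof
    assume ?P
    then obtain g h where gh: "\<exists>x\<in>X. g x \<noteq> 0 \<or> h x \<noteq> 0"
      "\<And>x. x \<in> X \<Longrightarrow> N h x = \<mu> * g x" "\<And>x. x \<in> X \<Longrightarrow> N g x = \<mu> * h x" by blast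
    have "N (N h) x = \<mu>\<^sup>2 * h x" "N (N g) x = \<mu>\<^sup>2 * g x" if "x \<in> X" for x
      using N_cong[of "N h" "\<lambda>x. \<mu> * g x" x] N_cong[of "N g" "\<lambda>x. \<mu> * h x" x] gh that
      by (auto simp: N_scale power2_eq_square)
    with gh(1) show ?Q by blast
  next
    assume ?Q
    then obtain h where h: "\<exists>x\<in>X. h x \<noteq> 0" "\<And>x. x \<in> X \<Longrightarrow> N (N h) x = \<mu>\<^sup>2 * h x" by blast
    \<comment> \<open>For nonzero \<open>\<mu>\<close> the partner of \<open>h\<close> is
      \<open>N h / \<mu>\<close>. For \<open>\<mu> = 0\<close> it is only known that
      \<open>N\<close> kills \<open>N h\<close>: if \<open>N h\<close> is nonzero it replaces
      \<open>h\<close>, otherwise \<open>h\<close> itself is killed by \<open>N\<close>; the other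
      colour class carries zero.\<close>
    show ?P
    proof (cases "\<mu> = 0")
      case False
      then show ?thesis using h
        by (intro exI[of _ "\<lambda>x. inverse \<mu> * N h x"] exI[of _ h])
           (auto simp only: N_scale power2_eq_square, auto)
    next
      case True
      have N0: "N (\<lambda>_. 0) x = 0" for x by (simp add: N_def)
      show ?thesis
      proof (cases "\<exists>x\<in>X. N h x \<noteq> 0")
        case nz: True
        then show ?thesis using h True N0
          by (intro exI[of _ "\<lambda>_. 0"] exI[of _ "N h"]) auto
      next
        case False
        then show ?thesis using h True N0
          by (intro exI[of _ "\<lambda>_. 0"] exI[of _ h]) auto
      qed
    qed
  qed
  also have "?Q \<longleftrightarrow> kernel_eigenvalue X (\<lambda>x y. of_nat (card {z\<in>X. E x z \<and> E y z})) (\<mu>\<^sup>2)"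
    unfolding kernel_eigenvalue_def by (simp add: NN)
  finally show ?thesis using pairs by simp
qed

text \<open>Proper refinement is expressed through class sizes because the sizes are computed
  anyway. It guarantees that every index carries a nonzero eigenfunction. Nothing is asked of the
  nesting beyond \<open>m\<close>.\<close>

locale uniform_chain =
  fixes X :: "'x set" and E :: "nat \<Rightarrow> 'x \<Rightarrow> 'x \<Rightarrow> bool" and m :: nat and s :: "nat \<Rightarrow> nat"
  assumes fin: "finite X" and nonempty: "X \<noteq> {}"
    and E_refl: "x \<in> X \<Longrightarrow> E i x x"
    and E_sym: "x \<in> X \<Longrightarrow> y \<in> X \<Longrightarrow> E i x y \<Longrightarrow> E i y x"
    and E_trans: "x \<in> X \<Longrightarrow> y \<in> X \<Longrightarrow> z \<in> X \<Longrightarrow> E i x y \<Longrightarrow> E i y z \<Longrightarrow> E i x z"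
    and E_antimono: "i \<le> j \<Longrightarrow> j \<le> m \<Longrightarrow> x \<in> X \<Longrightarrow> y \<in> X \<Longrightarrow> E j x y \<Longrightarrow> E i x y"
    and E_first: "x \<in> X \<Longrightarrow> y \<in> X \<Longrightarrow> E 0 x y"
    and E_last: "x \<in> X \<Longrightarrow> y \<in> X \<Longrightarrow> E m x y \<Longrightarrow> x = y"
    and class_card: "i \<le> m \<Longrightarrow> x \<in> X \<Longrightarrow> card {y\<in>X. E i x y} = s i"
    and strict: "i < m \<Longrightarrow> s i \<noteq> s (Suc i)"
begin

definition class_sum :: "nat \<Rightarrow> ('x \<Rightarrow> complex) \<Rightarrow> 'x \<Rightarrow> complex" where
  "class_sum i f x = (\<Sum>y | y \<in> X \<and> E i x y. f y)"

lemma E_commute: "x \<in> X \<Longrightarrow> y \<in> X \<Longrightarrow> E i x y = E i y x"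
  using E_sym by blast

lemma E_cong:
  assumes "x \<in> X" "y \<in> X" "z \<in> X" "E i y z"
  shows "E i x y = E i x z"
  using E_trans[OF assms(1-3) _ assms(4)] E_trans[OF assms(1,3,2) _ E_sym[OF assms(2-4)]] by blast

lemma class_sum_const:
  assumes "i \<le> m" "x \<in> X" "\<And>y. y \<in> X \<Longrightarrow> E i x y \<Longrightarrow> f y = f x"
  shows "class_sum i f x = of_nat (s i) * f x"
proof -
  have "class_sum i f x = (\<Sum>y | y \<in> X \<and> E i x y. f x)"
    unfolding class_sum_def using assms by (intro sum.cong) auto
  then show ?thesis using class_card[OF assms(1,2)] by simp
qed

lemma class_sum_last: "x \<in> X \<Longrightarrow> class_sum m f x = f x"
proof -
  assume x: "x \<in> X"
  then have "{y. y \<in> X \<and> E m x y} = {x}" using E_last E_refl by blast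
  then show ?thesis by (simp add: class_sum_def)
qed

text \<open>The \<open>E j\<close> class of x is a union of \<open>E i\<close> classes, so each
  value \<open>f z\<close> in it is counted once for every member of the \<open>E i\<close> class of
  z.\<close>

lemma class_sum_class_sum:
  assumes "j \<le> i" "i \<le> m" "x \<in> X"
  shows "class_sum j (class_sum i f) x = of_nat (s i) * class_sum j f x"
proof -
  have "class_sum j (class_sum i f) x =
      (\<Sum>y\<in>X. \<Sum>z\<in>X. if E j x y \<and> E i y z then f z else 0)"
    unfolding class_sum_def sum.inter_filter[OF fin] by (intro sum.cong) auto
  also have "\<dots> = (\<Sum>z\<in>X. \<Sum>y\<in>X. if E j x z \<and> E i z y then f z else 0)"
  proof (subst sum.swap, intro sum.cong refl)
    fix y z assume "y \<in> X" "z \<in> X"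
    then have "E j x y \<and> E i y z \<longleftrightarrow> E j x z \<and> E i z y"
      using E_cong[OF assms(3), of y z j] E_antimono[OF assms(1,2), of y z] E_commute[of y z i] by blast
    then show "(if E j x y \<and> E i y z then f z else 0) = (if E j x z \<and> E i z y then f z else 0)"
      by simp
  qed
  also have "\<dots> = (\<Sum>z\<in>X. if E j x z then of_nat (s i) * f z else 0)"
    using fin assms
    by (intro sum.cong) (auto simp: sum.inter_filter[symmetric] class_card)
  also have "\<dots> = of_nat (s i) * class_sum j f x"
    unfolding class_sum_def using fin
    by (simp add: sum.inter_filter[symmetric] sum_distrib_left)
  finally show ?thesis .
qed

lemma class_sum_sum:
  "class_sum j (\<lambda>x. \<Sum>i\<in>I. c i * F i x) x = (\<Sum>i\<in>I. c i * class_sum j (F i) x)"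
  unfolding class_sum_def by (subst sum.swap) (simp add: sum_distrib_left)

lemma class_subset: "i < m \<Longrightarrow> x \<in> X \<Longrightarrow> {y\<in>X. E (Suc i) x y} \<subset> {y\<in>X. E i x y}"
proof -
  assume i: "i < m" and x: "x \<in> X"
  have "{y\<in>X. E (Suc i) x y} \<subseteq> {y\<in>X. E i x y}"
    using E_antimono[of i "Suc i"] i x by auto
  moreover have "card {y\<in>X. E (Suc i) x y} \<noteq> card {y\<in>X. E i x y}"
    using class_card strict i x by (metis Suc_leI less_imp_le)
  ultimately show ?thesis by auto
qed

text \<open>On functions that are constant on the classes of \<^term>\<open>E i\<close> and have sum zero on the
  classes of the next coarser relation, the indicator kernel of \<^term>\<open>E k\<close> acts as
  multiplication by \<^term>\<open>s k\<close> if \<open>k \<ge> i\<close> and as zero if \<open>k < i\<close>.\<close>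

lemma kernel_eigenvalue_iff:
  fixes c :: "nat \<Rightarrow> real"
  assumes K: "\<And>x y. x \<in> X \<Longrightarrow> y \<in> X \<Longrightarrow> K x y = of_real (\<Sum>i\<le>m. if E i x y then c i else 0)"
  shows "kernel_eigenvalue X K \<mu> \<longleftrightarrow> (\<exists>i\<le>m. \<mu> = of_real (\<Sum>k=i..m. c k * real (s k)))"
proof -
  have KS: "(\<Sum>y\<in>X. K x y * h y) = (\<Sum>i\<le>m. of_real (c i) * class_sum i h x)" if "x \<in> X" for x h
  proof -
    have "(\<Sum>y\<in>X. K x y * h y) = (\<Sum>y\<in>X. \<Sum>i\<le>m. of_real (c i) * (if E i x y then h y else 0))"
      using that by (intro sum.cong) (auto simp: K sum_distrib_right intro!: sum.cong)
    then show ?thesis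
      unfolding class_sum_def using fin
      by (subst (asm) sum.swap) (simp add: sum.inter_filter sum_distrib_left)
  qed
  show ?thesis
  proof
    assume "kernel_eigenvalue X K \<mu>"
    then obtain h where nz: "\<exists>x\<in>X. h x \<noteq> 0"
      and ev: "\<And>x. x \<in> X \<Longrightarrow> (\<Sum>i\<le>m. of_real (c i) * class_sum i h x) = \<mu> * h x"
      unfolding kernel_eigenvalue_def using KS by auto
    \<comment> \<open>\<open>E j\<close> is the coarsest relation over which \<open>h\<close> has a
      nonzero class sum. Summing the eigenvalue equation over such a class kills the terms below
      \<open>j\<close> and turns every other term into \<open>s i\<close> times the same nonzero
      number, so no decomposition of the function space is needed.\<close>
    define j where "j = (LEAST j. \<exists>x\<in>X. class_sum j h x \<noteq> 0)"
    have exm: "\<exists>x\<in>X. class_sum m h x \<noteq> 0"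
      using nz class_sum_last by auto
    have jm: "j \<le> m"
      unfolding j_def by (rule Least_le) (rule exm)
    obtain x where x: "x \<in> X" "class_sum j h x \<noteq> 0"
      using LeastI[of "\<lambda>j. \<exists>x\<in>X. class_sum j h x \<noteq> 0", OF exm] unfolding j_def by blast
    have zero: "class_sum i h y = 0" if "i < j" "y \<in> X" for i y
      using not_less_Least[of i "\<lambda>j. \<exists>x\<in>X. class_sum j h x \<noteq> 0"] that unfolding j_def by blast
    have zero': "class_sum j (class_sum i h) x = 0" if "i < j" for i
      unfolding class_sum_def[of j] using zero that by (intro sum.neutral) auto
    have "\<mu> * class_sum j h x = class_sum j (\<lambda>y. \<mu> * h y) x"
      by (simp add: class_sum_def sum_distrib_left)
    also have "\<dots> = class_sum j (\<lambda>y. \<Sum>i\<le>m. of_real (c i) * class_sum i h y) x"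
      unfolding class_sum_def[of j] using ev by (intro sum.cong) auto
    also have "\<dots> = (\<Sum>i\<le>m. of_real (c i) * class_sum j (class_sum i h) x)"
      by (rule class_sum_sum)
    also have "\<dots> = (\<Sum>i=j..m. of_real (c i) * class_sum j (class_sum i h) x)"
      using zero' by (intro sum.mono_neutral_right) auto
    also have "\<dots> = (\<Sum>i=j..m. of_real (c i * real (s i)) * class_sum j h x)"
      using x by (intro sum.cong) (auto simp: class_sum_class_sum)
    also have "\<dots> = of_real (\<Sum>i=j..m. c i * real (s i)) * class_sum j h x"
      by (simp add: sum_distrib_right)
    finally have "\<mu> = of_real (\<Sum>i=j..m. c i * real (s i))"
      using x(2) by simp
    with jm show "\<exists>i\<le>m. \<mu> = of_real (\<Sum>k=i..m. c k * real (s k))" by blast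
  next
    assume "\<exists>i\<le>m. \<mu> = of_real (\<Sum>k=i..m. c k * real (s k))"
    then obtain j where jm: "j \<le> m" and mu: "\<mu> = of_real (\<Sum>k=j..m. c k * real (s k))" by blast
    have "\<exists>h. (\<exists>x\<in>X. h x \<noteq> 0) \<and> (\<forall>x\<in>X. \<forall>y\<in>X. E j x y \<longrightarrow> h y = h x) \<and>
        (\<forall>i<j. \<forall>x\<in>X. class_sum i h x = 0)"
    proof (cases j)
      case 0
      then show ?thesis using nonempty by (intro exI[of _ "\<lambda>_. 1"]) auto
    next
      case (Suc j')
      obtain a where a: "a \<in> X" using nonempty by blast
      obtain b where b: "b \<in> X" "E j' a b" "\<not> E j a b"
        using class_subset[of j' a] a Suc jm by auto
      \<comment> \<open>Difference of the indicators of two \<open>E j\<close> classes that lie in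
        one class of the preceding relation \<open>E j'\<close>. A class of any coarser relation
        contains both or neither, so its sum is zero.\<close>
      define h :: "'x \<Rightarrow> complex" where
        "h x = (if E j a x then 1 else 0) - (if E j b x then 1 else 0)" for x
      have "h a \<noteq> 0"
        using a b E_refl E_sym[of b a j] by (auto simp: h_def)
      moreover have "h y = h x" if "x \<in> X" "y \<in> X" "E j x y" for x y
      proof -
        have "E j a x = E j a y" "E j b x = E j b y"
          using that a b(1) E_cong by blast+
        then show ?thesis by (simp add: h_def)
      qed
      moreover have "class_sum i h x = 0" if i: "i < j" and x: "x \<in> X" for i x
      proof -
        have ind: "(\<Sum>y | y \<in> X \<and> E i x y. if E j u y then 1 else 0) =
            (if E i x u then of_nat (s j) else (0::complex))" if u: "u \<in> X" for u
        proof -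
          have "E i x y \<and> E j u y \<longleftrightarrow> E i x u \<and> E j u y" if y: "y \<in> X" for y
            using E_cong[OF x u y, of i] E_antimono[OF less_imp_le[OF i] jm u y] by blast
          then have "{y. y \<in> X \<and> E i x y \<and> E j u y} = {y. y \<in> X \<and> E i x u \<and> E j u y}"
            by blast
          then show ?thesis
            using fin class_card[OF jm u]
            by (auto simp: sum.inter_filter[symmetric] conj_assoc)
        qed
        have "E i a b"
          using E_antimono[of i j' a b] a b i jm Suc by simp
        then have "E i x a = E i x b"
          using a b(1) x E_cong by blast
        then show ?thesis
          unfolding class_sum_def h_def sum_subtractf ind[OF a] ind[OF b(1)] by simp
      qed
      ultimately show ?thesis using a by blast
    qed
    then obtain h where h: "\<exists>x\<in>X. h x \<noteq> 0" "\<And>x y. x \<in> X \<Longrightarrow> y \<in> X \<Longrightarrow> E j x y \<Longrightarrow> h y = h x"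
      "\<And>i x. i < j \<Longrightarrow> x \<in> X \<Longrightarrow> class_sum i h x = 0"
      by blast
    have "(\<Sum>y\<in>X. K x y * h y) = \<mu> * h x" if x: "x \<in> X" for x
    proof -
      have "(\<Sum>y\<in>X. K x y * h y) = (\<Sum>i=j..m. of_real (c i) * class_sum i h x)"
        unfolding KS[OF x] using h(3) x by (intro sum.mono_neutral_right) auto
      also have "\<dots> = (\<Sum>i=j..m. of_real (c i * real (s i)) * h x)"
      proof (rule sum.cong)
        fix i assume i: "i \<in> {j..m}"
        have "class_sum i h x = of_nat (s i) * h x"
          using i x h(2) E_antimono[of j i] by (intro class_sum_const) auto
        then show "of_real (c i) * class_sum i h x = of_real (c i * real (s i)) * h x" by simp
      qed simp
      finally show ?thesis by (simp add: mu sum_distrib_right)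
    qed
    with h(1) show "kernel_eigenvalue X K \<mu>" unfolding kernel_eigenvalue_def by blast
  qed
qed

end

section \<open>Finite valuation rings\<close>

lemma ideal_generated_singleton:
  "ideal_generated {x :: 'a::comm_ring_1} = {y. x dvd y}"
proof (rule hull_unique)
  fix T assume "{x} \<subseteq> T" "is_ideal T"
  then show "{y. x dvd y} \<subseteq> T"
    by (auto simp: is_ideal_def dvd_def mult.commute[of x])
qed (auto simp: is_ideal_def)

lemma is_ideal_UNIV_if_unit:
  assumes "is_ideal I" "u \<in> I" "u dvd (1 :: 'a::comm_ring_1)"
  shows "I = UNIV"
proof -
  obtain v where "1 = u * v" using assms(3) by (auto simp: dvd_def)
  then have "x = (x * v) * u" for x by (metis mult.assoc mult.commute mult.right_neutral)
  then have "x \<in> I" for x using assms(1,2) unfolding is_ideal_def by metis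
  then show ?thesis by auto
qed

lemma dvd_diff_swap: "x dvd y - z \<longleftrightarrow> x dvd z - (y :: 'a::comm_ring_1)"
  by (metis dvd_minus_iff minus_diff_eq)

lemma card_eq_mult_card_image:
  assumes "finite A" "\<And>y. y \<in> f ` A \<Longrightarrow> card {x\<in>A. f x = y} = k"
  shows "card A = card (f ` A) * k"
proof -
  have "card A = (\<Sum>y\<in>f ` A. card {x\<in>A. f x = y})"
    using assms(1) by (subst card_UN_disjoint[symmetric]) (auto intro!: arg_cong[of _ _ card])
  then show ?thesis using assms(2) by simp
qed

text \<open>Coordinatewise conditions on a vector become a dependent product of sets, whose
  cardinality is known.\<close>

lemma bij_betw_vec_PiE:
  "bij_betw (vec n) (Pi\<^sub>E {..<n} S) {v \<in> carrier_vec n. \<forall>i<n. v $ i \<in> S i}"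
proof (rule bij_betwI[where g = "\<lambda>v. restrict (($) v) {..<n}"])
  show "vec n \<in> Pi\<^sub>E {..<n} S \<rightarrow> {v \<in> carrier_vec n. \<forall>i<n. v $ i \<in> S i}"
    by (rule funcsetI) (simp add: PiE_iff)
  show "(\<lambda>v. restrict (($) v) {..<n}) \<in> {v \<in> carrier_vec n. \<forall>i<n. v $ i \<in> S i} \<rightarrow> Pi\<^sub>E {..<n} S"
    by (rule funcsetI) simp
  show "restrict (($) (vec n f)) {..<n} = f" if "f \<in> Pi\<^sub>E {..<n} S" for f
    using that by (intro ext) (simp add: PiE_iff extensional_def restrict_def)
  show "vec n (restrict (($) v) {..<n}) = v" if "v \<in> {v \<in> carrier_vec n. \<forall>i<n. v $ i \<in> S i}" for v
    using that by (intro eq_vecI) auto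
qed

lemma card_vec_entries:
  "card {v \<in> carrier_vec n. \<forall>i<n. v $ i \<in> S i} = (\<Prod>i<n. card (S i))"
  using bij_betw_same_card[OF bij_betw_vec_PiE[of n S]] by (simp add: card_PiE)

lemma finite_carrier_vec: "finite (carrier_vec n :: 'a::finite vec set)"
  using bij_betw_finite[OF bij_betw_vec_PiE[of n "\<lambda>_. UNIV :: 'a set"]] by (simp add: finite_PiE)

locale uniformizer =
  fixes \<pi> :: "'a::finite_valuation_ring" and q l :: nat
  assumes maximal: "is_maximal_ideal (ideal_generated {\<pi>})"
    and q_def: "q = quotient_ring_card (ideal_generated {\<pi>})"
    and odd_q: "odd q"
    and l_def: "l = (LEAST j. 0 < j \<and> \<pi> ^ j = 0)"
begin

lemma not_pi_dvd_one: "\<not> \<pi> dvd 1"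
proof
  assume "\<pi> dvd 1"
  then have "ideal_generated {\<pi>} = UNIV"
    unfolding ideal_generated_singleton using dvd_trans[OF _ one_dvd] by auto
  with maximal show False by (simp add: is_maximal_ideal_def)
qed

text \<open>The multiples of a nonunit form a proper ideal. By finiteness it lies in a maximal one,
  and locality leaves only (\<pi>).\<close>

lemma pi_dvd_if_not_unit:
  assumes "\<not> x dvd 1"
  shows "\<pi> dvd x"
proof -
  let ?S = "{I. is_ideal I \<and> I \<noteq> UNIV \<and> {y. x dvd y} \<subseteq> I}"
  have "{y. x dvd y} \<in> ?S" using assms by (auto simp: is_ideal_def)
  then obtain M where M: "M \<in> ?S" "\<And>I. I \<in> ?S \<Longrightarrow> M \<subseteq> I \<Longrightarrow> M = I"
    using finite_has_maximal[of ?S] by (metis (no_types, lifting) empty_iff finite)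
  have "is_maximal_ideal M"
    unfolding is_maximal_ideal_def
  proof (intro conjI allI impI)
    fix J assume "is_ideal J \<and> M \<subseteq> J"
    then show "J = M \<or> J = UNIV" using M(1) M(2)[of J] by blast
  qed (use M(1) in blast)+
  then have "M = {y. \<pi> dvd y}"
    using maximal local_ring unfolding ideal_generated_singleton by blast
  moreover have "x \<in> M" using M(1) by (simp add: subset_iff)
  ultimately show ?thesis by simp
qed

lemma unit_iff: "x dvd 1 \<longleftrightarrow> \<not> \<pi> dvd x"
  using pi_dvd_if_not_unit not_pi_dvd_one dvd_trans by blast

text \<open>By finiteness two powers agree, so \<open>\<pi> ^ i\<close> times
  \<open>1 - \<pi> ^ (j - i)\<close> is zero, and the second factor is a unit.\<close>

lemma pi_nilpotent: "\<exists>j>0. \<pi> ^ j = 0"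
proof -
  have "\<not> inj ((^) \<pi> :: nat \<Rightarrow> 'a)"
    using finite_imageD[of "(^) \<pi>" "UNIV :: nat set"] by (metis finite infinite_UNIV_nat)
  then obtain i j where ij: "\<pi> ^ i = \<pi> ^ j" "i < j"
    by (metis injI linorder_neqE_nat)
  have "\<pi> ^ i * \<pi> ^ (j - i) = \<pi> ^ j" using ij(2) by (metis power_add le_add_diff_inverse less_imp_le)
  then have eq: "\<pi> ^ i * (1 - \<pi> ^ (j - i)) = 0" using ij(1) by (simp add: right_diff_distrib)
  have "\<pi> dvd \<pi> ^ (j - i)" using ij(2) by (simp add: dvd_power)
  then have "\<not> \<pi> dvd 1 - \<pi> ^ (j - i)"
    using not_pi_dvd_one by (metis dvd_add diff_add_cancel)
  then obtain v where "1 = (1 - \<pi> ^ (j - i)) * v"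
    using unit_iff by (metis dvdE)
  then have "\<pi> ^ i = (\<pi> ^ i * (1 - \<pi> ^ (j - i))) * v"
    by (metis mult.assoc mult.right_neutral)
  then have "\<pi> ^ i = 0" using eq by simp
  \<comment> \<open>\<open>i\<close> itself may be 0; its successor is a positive exponent.\<close>
  then show ?thesis by (intro exI[of _ "Suc i"]) simp
qed

lemma l_pos: "0 < l" and pi_power_l: "\<pi> ^ l = 0"
  using LeastI_ex[OF pi_nilpotent] by (simp_all add: l_def)

lemma pi_power_nonzero: "j < l \<Longrightarrow> \<pi> ^ j \<noteq> 0"
  using not_less_Least[of j "\<lambda>j. 0 < j \<and> \<pi> ^ j = 0"] by (cases "j = 0") (auto simp: l_def)

lemma pi_power_eq_0: "l \<le> j \<Longrightarrow> \<pi> ^ j = 0"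
  using pi_power_l by (metis le_imp_power_dvd dvd_0_left)

text \<open>Replaces cancellation, which fails in the presence of zero divisors: were x a unit, so
  would be \<open>x - \<pi> * r\<close>, and then \<open>\<pi> ^ i\<close> would vanish although
  \<open>i < l\<close>.\<close>

lemma pi_power_dvd_cancel:
  assumes "\<pi> ^ Suc i dvd \<pi> ^ i * x" "i < l"
  shows "\<pi> dvd x"
proof (rule ccontr)
  assume nx: "\<not> \<pi> dvd x"
  obtain r where r: "\<pi> ^ i * x = \<pi> ^ i * (\<pi> * r)"
    using assms(1) by (auto simp: dvd_def mult.assoc mult.left_commute)
  then have eq: "\<pi> ^ i * (x - \<pi> * r) = 0" by (simp add: right_diff_distrib)
  have "\<not> \<pi> dvd x - \<pi> * r" using nx by (metis dvd_add dvd_triv_left diff_add_cancel)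
  then obtain v where "1 = (x - \<pi> * r) * v" using unit_iff by (metis dvdE)
  then have "\<pi> ^ i = (\<pi> ^ i * (x - \<pi> * r)) * v" by (metis mult.assoc mult.right_neutral)
  then show False using eq pi_power_nonzero[OF assms(2)] by simp
qed

text \<open>Representatives of the residue classes, to be used as leading digits in expansions along
  powers of \<pi>.\<close>

lemma ex_transversal:
  obtains T where "card T = q" "\<And>x. \<exists>t\<in>T. \<pi> dvd x - t"
    "\<And>s t. s \<in> T \<Longrightarrow> t \<in> T \<Longrightarrow> \<pi> dvd s - t \<Longrightarrow> s = t"
proof -
  let ?r = "{(x, y). \<pi> dvd x - y}"
  have equiv: "equiv UNIV ?r"
  proof (rule equivI)
    show "sym ?r" by (rule symI) (simp add: dvd_diff_swap)
    show "trans ?r"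
    proof (rule transI)
      fix x y z assume "(x, y) \<in> ?r" "(y, z) \<in> ?r"
      then show "(x, z) \<in> ?r" using dvd_add[of \<pi> "x - y" "y - z"] by simp
    qed
  qed (auto simp: refl_on_def)
  define rep where "rep C = (SOME x. x \<in> C)" for C :: "'a set"
  have rep: "rep C \<in> C" if "C \<in> UNIV // ?r" for C
    using in_quotient_imp_non_empty[OF equiv that] unfolding rep_def by (simp add: some_in_eq)
  have inj: "inj_on rep (UNIV // ?r)"
    using rep quotient_disj[OF equiv] by (intro inj_onI) (metis disjoint_iff)
  show ?thesis
  proof
    show "card (rep ` (UNIV // ?r)) = q"
      using card_image[OF inj] by (simp add: q_def quotient_ring_card_def ideal_generated_singleton)
    show "\<exists>t\<in>rep ` (UNIV // ?r). \<pi> dvd x - t" for x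
    proof (rule bexI)
      have C: "?r `` {x} \<in> UNIV // ?r" by (rule quotientI) simp
      then show "rep (?r `` {x}) \<in> rep ` (UNIV // ?r)" by simp
      show "\<pi> dvd x - rep (?r `` {x})" using rep[OF C] by simp
    qed
    fix s t assume "s \<in> rep ` (UNIV // ?r)" "t \<in> rep ` (UNIV // ?r)" and d: "\<pi> dvd s - t"
    then obtain C D where CD: "C \<in> UNIV // ?r" "D \<in> UNIV // ?r" "s = rep C" "t = rep D" by auto
    have "C = D"
      using quotient_eqI[OF equiv CD(1,2) rep[OF CD(1)] rep[OF CD(2)]] d CD by simp
    then show "s = t" using CD by simp
  qed
qed

text \<open>0 and 1 represent different residues, and parity rules out 2. With q = 2 every unit
  would be 1 modulo \<pi>, so congruence and proportionality modulo \<pi> would coincide on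
  unimodular vectors and the chain for Um would not be strict.\<close>

lemma q_ge_3: "3 \<le> q"
proof -
  obtain T where T: "card T = q" "\<And>x. \<exists>t\<in>T. \<pi> dvd x - t" by (rule ex_transversal) blast
  obtain s t where st: "s \<in> T" "t \<in> T" "\<pi> dvd 0 - s" "\<pi> dvd 1 - t" using T(2) by metis
  have "s \<noteq> t"
  proof
    assume "s = t"
    then have "\<pi> dvd (1 - t) - (0 - s)" using dvd_diff[OF st(4,3)] by simp
    then show False using not_pi_dvd_one \<open>s = t\<close> by simp
  qed
  then have "card {s, t} \<le> card T" using st by (intro card_mono) auto
  then have "2 \<le> q" using \<open>s \<noteq> t\<close> T(1) by simp
  then show ?thesis using odd_q by (cases "q = 2") auto
qed

text \<open>Every multiple of \<open>\<pi> ^ i\<close> is uniquely \<open>\<pi> ^ i * t + y\<close>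
  with a digit \<open>t\<close> and \<open>y\<close> a multiple of the next power.\<close>

lemma card_pi_power_step:
  assumes "i < l"
  shows "card {x. \<pi> ^ i dvd x} = q * card {x. \<pi> ^ Suc i dvd x}"
proof -
  obtain T where T: "card T = q" "\<And>x. \<exists>t\<in>T. \<pi> dvd x - t"
    "\<And>s t. s \<in> T \<Longrightarrow> t \<in> T \<Longrightarrow> \<pi> dvd s - t \<Longrightarrow> s = t" by (rule ex_transversal) blast
  let ?f = "\<lambda>(t, y). \<pi> ^ i * t + y"
  have "bij_betw ?f (T \<times> {x. \<pi> ^ Suc i dvd x}) {x. \<pi> ^ i dvd x}"
    unfolding bij_betw_def
  proof
    show "inj_on ?f (T \<times> {x. \<pi> ^ Suc i dvd x})"
    proof (rule inj_onI, clarify)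
      fix t y t' y'
      assume h: "t \<in> T" "t' \<in> T" "\<pi> ^ Suc i dvd y" "\<pi> ^ Suc i dvd y'"
        "\<pi> ^ i * t + y = \<pi> ^ i * t' + y'"
      have "\<pi> ^ i * (t - t') = y' - y" using h(5) by (simp add: algebra_simps)
      then have "\<pi> ^ Suc i dvd \<pi> ^ i * (t - t')" using dvd_diff[OF h(4,3)] by simp
      then have "t = t'" using pi_power_dvd_cancel assms T(3) h by blast
      with h(5) show "t = t' \<and> y = y'" by simp
    qed
    show "?f ` (T \<times> {x. \<pi> ^ Suc i dvd x}) = {x. \<pi> ^ i dvd x}"
    proof (intro equalityI subsetI)
      fix x assume "x \<in> ?f ` (T \<times> {x. \<pi> ^ Suc i dvd x})"
      then obtain t y where "x = \<pi> ^ i * t + y" "\<pi> ^ Suc i dvd y" by auto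
      then show "x \<in> {x. \<pi> ^ i dvd x}"
        using dvd_trans[OF le_imp_power_dvd[of i "Suc i" \<pi>]] by (auto intro!: dvd_add)
    next
      fix x assume "x \<in> {x. \<pi> ^ i dvd x}"
      then obtain r where r: "x = \<pi> ^ i * r" by auto
      obtain t where t: "t \<in> T" "\<pi> dvd r - t" using T(2) by blast
      have "x = \<pi> ^ i * t + \<pi> ^ i * (r - t)" by (simp add: r algebra_simps)
      moreover have "\<pi> ^ Suc i dvd \<pi> ^ i * (r - t)"
        using mult_dvd_mono[OF dvd_refl t(2), of "\<pi> ^ i"] by (simp add: mult.commute)
      ultimately show "x \<in> ?f ` (T \<times> {x. \<pi> ^ Suc i dvd x})"
        using t(1) by (intro image_eqI[of _ _ "(t, \<pi> ^ i * (r - t))"]) auto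
    qed
  qed
  from bij_betw_same_card[OF this] show ?thesis using T(1) by (simp add: card_cartesian_product)
qed

text \<open>Truncated subtraction keeps this valid beyond \<open>l\<close>, where the ideal is zero;
  the counts for Um0 rely on that.\<close>

lemma card_pi_power: "card {x. \<pi> ^ i dvd x} = q ^ (l - i)"
proof (cases "i \<le> l")
  case True
  then show ?thesis
  proof (induction rule: inc_induct)
    case base
    then show ?case by (simp add: pi_power_l)
  next
    case (step j)
    then show ?case using card_pi_power_step[of j] by (simp add: Suc_diff_Suc flip: power_Suc)
  qed
next
  case False
  then show ?thesis by (simp add: pi_power_eq_0)
qed

lemma card_ring: "card (UNIV :: 'a set) = q ^ l"
  using card_pi_power[of 0] by simp

lemma card_units: "card {u :: 'a. u dvd 1} = q ^ (l - 1) * (q - 1)"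
proof -
  have "{u. u dvd 1} = UNIV - {x. \<pi> ^ 1 dvd x}" using unit_iff by auto
  then have "card {u :: 'a. u dvd 1} = q ^ l - q ^ (l - 1)"
    by (simp only: card_Diff_subset[OF finite subset_UNIV] card_pi_power card_ring)
  then show ?thesis using l_pos by (cases l) (auto simp: algebra_simps)
qed

lemma field_iff: "(\<forall>x::'a. x \<noteq> 0 \<longrightarrow> x dvd 1) \<longleftrightarrow> l = 1"
proof
  assume f: "\<forall>x::'a. x \<noteq> 0 \<longrightarrow> x dvd 1"
  show "l = 1"
  proof (rule ccontr)
    assume "l \<noteq> 1"
    then have "\<pi> \<noteq> 0" using pi_power_nonzero[of 1] l_pos by simp
    then show False using f not_pi_dvd_one by blast
  qed
next
  assume "l = 1"
  then have "\<pi> = 0" using pi_power_l by simp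
  then show "\<forall>x::'a. x \<noteq> 0 \<longrightarrow> x dvd 1" by (simp add: unit_iff)
qed

text \<open>In a local ring, entries that are all nonunits stay inside the maximal ideal and cannot
  generate 1; a single unit entry already does.\<close>

lemma unimodular_iff:
  "a \<in> unimodular_vecs n \<longleftrightarrow> a \<in> carrier_vec n \<and> (\<exists>i<n. \<not> \<pi> dvd a $ i)"
proof -
  have "ideal_generated (set\<^sub>v a) = UNIV \<longleftrightarrow> (\<exists>i<n. \<not> \<pi> dvd a $ i)" if a: "a \<in> carrier_vec n"
  proof
    assume h: "ideal_generated (set\<^sub>v a) = UNIV"
    show "\<exists>i<n. \<not> \<pi> dvd a $ i"
    proof (rule ccontr)
      assume "\<not> ?thesis"
      then have "set\<^sub>v a \<subseteq> {x. \<pi> dvd x}" using a by (auto simp: vec_set_def)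
      moreover have "is_ideal {x. \<pi> dvd x}" by (auto simp: is_ideal_def)
      ultimately have "ideal_generated (set\<^sub>v a) \<subseteq> {x. \<pi> dvd x}" by (rule hull_minimal)
      then show False using h not_pi_dvd_one by auto
    qed
  next
    assume "\<exists>i<n. \<not> \<pi> dvd a $ i"
    then obtain i where i: "i < n" "a $ i dvd 1" using unit_iff by blast
    have "a $ i \<in> ideal_generated (set\<^sub>v a)"
      using i a by (intro hull_inc) (auto simp: vec_set_def)
    moreover have "is_ideal (ideal_generated (set\<^sub>v a))"
      by (rule hull_in) (auto simp: is_ideal_def)
    ultimately show "ideal_generated (set\<^sub>v a) = UNIV" using i(2) is_ideal_UNIV_if_unit by blast
  qed
  then show ?thesis by (auto simp: unimodular_vecs_def)
qed

end

section \<open>Counting vectors\<close>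

lemma scalar_prod_two_entries:
  fixes a :: "'a::comm_ring_1 vec"
  assumes "i < n" "k < n" "i \<noteq> k"
  shows "a \<bullet> vec n (\<lambda>m. if m = i then y else if m = k then z else 0) = a $ i * y + a $ k * z"
proof -
  have "a \<bullet> vec n (\<lambda>m. if m = i then y else if m = k then z else 0) =
      (\<Sum>m\<in>{0..<n}. (if m = i then a $ m * y else 0) + (if m = k then a $ m * z else 0))"
    unfolding scalar_prod_def using assms by (intro sum.cong) auto
  also have "\<dots> = a $ i * y + a $ k * z"
    using assms by (simp add: sum.distrib)
  finally show ?thesis .
qed

lemma scalar_prod_one_entry:
  fixes a :: "'a::comm_ring_1 vec"
  assumes "i < n"
  shows "a \<bullet> vec n (\<lambda>m. if m = i then y else 0) = a $ i * y"
proof -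
  have "a \<bullet> vec n (\<lambda>m. if m = i then y else 0) = (\<Sum>m\<in>{0..<n}. if m = i then a $ m * y else 0)"
    unfolding scalar_prod_def using assms by (intro sum.cong) auto
  then show ?thesis using assms by simp
qed

text \<open>Classes are counted through their representatives, as a product with the common class
  size so that no division occurs.\<close>

lemma card_quotient_filter:
  assumes "equiv A r" "finite A" "\<And>a. a \<in> A \<Longrightarrow> card (r `` {a}) = w"
  shows "card {b\<in>A. Q (r `` {b})} = card {B \<in> A // r. Q B} * w"
proof -
  let ?S = "{b\<in>A. Q (r `` {b})}"
  have img: "(\<lambda>b. r `` {b}) ` ?S = {B \<in> A // r. Q B}"
    by (auto simp: quotient_def)
  have "card {x\<in>?S. r `` {x} = B} = w" if B: "B \<in> (\<lambda>b. r `` {b}) ` ?S" for B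
  proof -
    obtain b where b: "b \<in> A" "Q (r `` {b})" "B = r `` {b}" using B by blast
    have "{x\<in>?S. r `` {x} = B} = r `` {b}"
      using b equiv_class_eq_iff[OF assms(1)] by auto
    then show ?thesis using assms(3) b by simp
  qed
  then show ?thesis
    using card_eq_mult_card_image[of ?S "\<lambda>b. r `` {b}" w] assms(2) img by auto
qed

context uniformizer
begin

section \<open>Congruence and proportionality modulo powers of the uniformizer\<close>

definition vcong :: "nat \<Rightarrow> nat \<Rightarrow> 'a vec \<Rightarrow> 'a vec \<Rightarrow> bool" where
  "vcong n j a b \<longleftrightarrow> (\<forall>i<n. \<pi> ^ j dvd b $ i - a $ i)"

definition scales :: "nat \<Rightarrow> nat \<Rightarrow> 'a \<Rightarrow> 'a vec \<Rightarrow> 'a vec \<Rightarrow> bool" where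
  "scales n j u a b \<longleftrightarrow> (\<forall>i<n. \<pi> ^ j dvd b $ i - u * a $ i)"

text \<open>The multiplier need not be declared a unit: for \<open>j > 0\<close> and unimodular
  \<open>b\<close> it is one by \<open>scales_unit\<close>. For \<open>j = 0\<close> the relation is
  total and serves as the coarsest member of the chain.\<close>

definition vprop :: "nat \<Rightarrow> nat \<Rightarrow> 'a vec \<Rightarrow> 'a vec \<Rightarrow> bool" where
  "vprop n j a b \<longleftrightarrow> (\<exists>u. scales n j u a b)"

lemma pi_power_dvd_mono: "i \<le> j \<Longrightarrow> \<pi> ^ j dvd x \<Longrightarrow> \<pi> ^ i dvd x"
  by (rule dvd_trans[OF le_imp_power_dvd])

lemma pi_dvd_if_power: "0 < j \<Longrightarrow> \<pi> ^ j dvd x \<Longrightarrow> \<pi> dvd x"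
  using pi_power_dvd_mono[of 1 j x] by simp

lemma dvd_zero_power: "\<pi> ^ l dvd x \<longleftrightarrow> x = 0"
  by (simp add: pi_power_l)

lemma vcong_iff_scales: "vcong n j a b \<longleftrightarrow> scales n j 1 a b"
  by (simp add: vcong_def scales_def)

lemma scales_mono: "i \<le> j \<Longrightarrow> scales n j u a b \<Longrightarrow> scales n i u a b"
  using pi_power_dvd_mono by (auto simp: scales_def)

lemma scales_mult:
  assumes "scales n j u a b" "scales n j v b c"
  shows "scales n j (v * u) a c"
  unfolding scales_def
proof (intro allI impI)
  fix i assume "i < n"
  then have "\<pi> ^ j dvd (c $ i - v * b $ i) + v * (b $ i - u * a $ i)"
    using assms by (auto simp: scales_def intro!: dvd_add)
  then show "\<pi> ^ j dvd c $ i - v * u * a $ i" by (simp add: algebra_simps)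
qed

lemma scales_inverse:
  assumes "scales n j u a b" "v * u = 1"
  shows "scales n j v b a"
  unfolding scales_def
proof (intro allI impI)
  fix i assume "i < n"
  then have "\<pi> ^ j dvd (- v) * (b $ i - u * a $ i)"
    using assms by (simp add: scales_def)
  moreover have "(- v) * (b $ i - u * a $ i) = (v * u) * a $ i - v * b $ i" by (simp add: algebra_simps)
  ultimately have "\<pi> ^ j dvd (v * u) * a $ i - v * b $ i" by (simp only:)
  then show "\<pi> ^ j dvd a $ i - v * b $ i" using assms(2) by simp
qed

lemma scales_unit:
  assumes "scales n j u a b" "0 < j" "b \<in> unimodular_vecs n"
  shows "\<not> \<pi> dvd u"
proof
  assume u: "\<pi> dvd u"
  have "\<pi> dvd b $ i" if "i < n" for i
  proof -
    have "\<pi> dvd b $ i - u * a $ i" using assms that pi_dvd_if_power by (simp add: scales_def)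
    then have "\<pi> dvd (b $ i - u * a $ i) + u * a $ i" using u by (intro dvd_add) auto
    then show ?thesis by simp
  qed
  then show False using assms(3) by (auto simp: unimodular_iff)
qed

lemma scales_unimodular:
  assumes "scales n j u a b" "0 < j" "a \<in> unimodular_vecs n" "b \<in> carrier_vec n" "\<not> \<pi> dvd u"
  shows "b \<in> unimodular_vecs n"
proof -
  obtain i where i: "i < n" "\<not> \<pi> dvd a $ i" using assms(3) by (auto simp: unimodular_iff)
  have "\<not> \<pi> dvd b $ i"
  proof
    assume "\<pi> dvd b $ i"
    moreover have "\<pi> dvd b $ i - u * a $ i" using assms i pi_dvd_if_power by (simp add: scales_def)
    ultimately have "\<pi> dvd b $ i - (b $ i - u * a $ i)" by (rule dvd_diff)
    then have "\<not> u * a $ i dvd 1" by (simp add: unit_iff)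
    moreover have "u * a $ i dvd 1"
      using mult_dvd_mono[of u 1 "a $ i" 1] assms(5) i(2) by (simp add: unit_iff)
    ultimately show False by simp
  qed
  then show ?thesis using assms(4) i by (auto simp: unimodular_iff)
qed

text \<open>Comparing both multipliers at a unit entry of \<open>a\<close> shows that the possible
  multipliers form exactly one coset of (\<pi>^j).\<close>

lemma scales_unique:
  assumes "scales n j u a b" "a \<in> unimodular_vecs n"
  shows "scales n j v a b \<longleftrightarrow> \<pi> ^ j dvd v - u"
proof
  assume v: "scales n j v a b"
  obtain i where i: "i < n" "a $ i dvd 1" using assms(2) by (auto simp: unimodular_iff unit_iff)
  obtain w where w: "1 = a $ i * w" using i(2) by (auto elim: dvdE)
  have "\<pi> ^ j dvd ((b $ i - u * a $ i) - (b $ i - v * a $ i)) * w"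
    using dvd_diff[of "\<pi> ^ j" "b $ i - u * a $ i" "b $ i - v * a $ i"] assms(1) v i(1)
    by (intro dvd_mult2) (simp add: scales_def)
  moreover have "((b $ i - u * a $ i) - (b $ i - v * a $ i)) * w = (v - u) * (a $ i * w)"
    by (simp add: algebra_simps)
  ultimately show "\<pi> ^ j dvd v - u" using w by simp
next
  assume d: "\<pi> ^ j dvd v - u"
  show "scales n j v a b"
    unfolding scales_def
  proof (intro allI impI)
    fix i assume "i < n"
    then have "\<pi> ^ j dvd (b $ i - u * a $ i) - (v - u) * a $ i"
      using dvd_diff[of "\<pi> ^ j" "b $ i - u * a $ i" "(v - u) * a $ i"] assms(1) d
      by (simp add: scales_def dvd_mult2)
    then show "\<pi> ^ j dvd b $ i - v * a $ i" by (simp add: algebra_simps)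
  qed
qed

lemma scales_refl: "scales n j 1 a a"
  by (simp add: scales_def)

lemma vcong_refl: "vcong n j a a"
  by (simp add: vcong_iff_scales scales_refl)

lemma vcong_sym: "vcong n j a b \<Longrightarrow> vcong n j b a"
  unfolding vcong_iff_scales by (erule scales_inverse) simp

lemma vcong_trans: "vcong n j a b \<Longrightarrow> vcong n j b c \<Longrightarrow> vcong n j a c"
  unfolding vcong_iff_scales using scales_mult[of n j 1 a b 1 c] by simp

lemma vcong_mono: "i \<le> j \<Longrightarrow> vcong n j a b \<Longrightarrow> vcong n i a b"
  unfolding vcong_iff_scales by (rule scales_mono)

lemma vcong_0: "vcong n 0 a b"
  by (simp add: vcong_def)

lemma vcong_l: "vcong n l a b \<Longrightarrow> a \<in> carrier_vec n \<Longrightarrow> b \<in> carrier_vec n \<Longrightarrow> a = b"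
  by (intro eq_vecI) (auto simp: vcong_def dvd_zero_power)

lemma vcong_imp_vprop: "vcong n j a b \<Longrightarrow> vprop n j a b"
  unfolding vcong_iff_scales vprop_def by blast

lemma vprop_refl: "vprop n j a a"
  unfolding vprop_def using scales_refl by blast

lemma vprop_0: "vprop n 0 a b"
  by (simp add: vprop_def scales_def)

lemma vprop_sym:
  assumes "b \<in> unimodular_vecs n" "vprop n j a b"
  shows "vprop n j b a"
proof (cases "j = 0")
  case False
  obtain u where u: "scales n j u a b" using assms(2) by (auto simp: vprop_def)
  then have "u dvd 1" using scales_unit assms False by (auto simp: unit_iff)
  then obtain v where "v * u = 1" by (metis dvdE mult.commute)
  then show ?thesis using scales_inverse[OF u] by (auto simp: vprop_def)
qed (simp add: vprop_0)

lemma vprop_trans: "vprop n j a b \<Longrightarrow> vprop n j b c \<Longrightarrow> vprop n j a c"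
  unfolding vprop_def using scales_mult by blast

lemma vprop_mono: "i \<le> j \<Longrightarrow> vprop n j a b \<Longrightarrow> vprop n i a b"
  unfolding vprop_def using scales_mono by blast

text \<open>Modulo \<open>\<pi> ^ l = 0\<close> proportionality is an exact equation, so it survives
  modulo every power, also beyond \<open>l\<close>.\<close>

lemma vprop_l: "vprop n l a b \<Longrightarrow> vprop n j a b"
  unfolding vprop_def scales_def dvd_zero_power by (metis dvd_0_right)

text \<open>Attaches to a pair the level \<open>j\<close> on which all common neighbour counts
  depend. Level \<open>l\<close> means exact proportionality.\<close>

lemma ex_vprop_level:
  obtains j where "j \<le> l" "\<And>i. i \<le> l \<Longrightarrow> vprop n i a b \<longleftrightarrow> i \<le> j"
proof -
  define J where "J = {i. i \<le> l \<and> vprop n i a b}"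
  have "finite J" "0 \<in> J" by (auto simp: J_def vprop_0)
  then have M: "Max J \<in> J" "\<And>i. i \<in> J \<Longrightarrow> i \<le> Max J" by (auto intro: Max_in)
  show ?thesis
  proof
    show "Max J \<le> l" using M(1) by (simp add: J_def)
    show "vprop n i a b \<longleftrightarrow> i \<le> Max J" if "i \<le> l" for i
      using M that vprop_mono by (auto simp: J_def)
  qed
qed

section \<open>Class sizes of congruence and proportionality\<close>

definition pi_vecs :: "nat \<Rightarrow> nat \<Rightarrow> 'a vec set" where
  "pi_vecs n e = {x \<in> carrier_vec n. \<forall>i<n. \<pi> ^ e dvd x $ i}"

lemma card_coset: "card {x. \<pi> ^ j dvd x - c} = q ^ (l - j)"
proof -
  have "bij_betw (\<lambda>x. x + c) {x. \<pi> ^ j dvd x} {x. \<pi> ^ j dvd x - c}"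
    by (rule bij_betwI[where g = "\<lambda>x. x - c"]) auto
  from bij_betw_same_card[OF this] show ?thesis by (simp add: card_pi_power)
qed

lemma card_scales: "card {b \<in> carrier_vec n. scales n j u a b} = q ^ ((l - j) * n)"
  unfolding scales_def
  using card_vec_entries[of n "\<lambda>i. {x. \<pi> ^ j dvd x - u * a $ i}"]
  by (simp add: card_coset power_mult)

lemma card_pi_vecs: "card (pi_vecs n e) = q ^ ((l - e) * n)"
  using card_vec_entries[of n "\<lambda>i. {x. \<pi> ^ e dvd x}"]
  by (simp add: pi_vecs_def card_pi_power power_mult)

lemma card_carrier: "card (carrier_vec n :: 'a vec set) = q ^ (l * n)"
  using card_pi_vecs[of n 0] by (simp add: pi_vecs_def)

lemma finite_vecs: "finite {x \<in> carrier_vec n :: 'a vec set. P x}" "finite (pi_vecs n e)"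
  "finite (unimodular_vecs n :: 'a vec set)"
  by (rule finite_subset[OF _ finite_carrier_vec[of n]]; auto simp: pi_vecs_def unimodular_vecs_def)+

lemma unimodular_eq: "unimodular_vecs n = carrier_vec n - pi_vecs n 1"
  by (auto simp: unimodular_iff pi_vecs_def)

lemma card_unimodular: "card (unimodular_vecs n :: 'a vec set) = q ^ (l * n) - q ^ ((l - 1) * n)"
  unfolding unimodular_eq
  by (subst card_Diff_subset) (auto simp: finite_vecs card_pi_vecs card_carrier, auto simp: pi_vecs_def)

text \<open>Double counting of pairs (u, b): a multiplier admits q^((l-j)n) vectors, and a vector
  admits one coset of multipliers, which lies wholly in \<open>V\<close> by the closure
  assumption.\<close>

lemma card_scales_some:
  assumes a: "a \<in> unimodular_vecs n"
    and V: "\<And>u v. u \<in> V \<Longrightarrow> \<pi> ^ j dvd v - u \<Longrightarrow> v \<in> V"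
  shows "card {b \<in> carrier_vec n. \<exists>u\<in>V. scales n j u a b} * q ^ (l - j) = card V * q ^ ((l - j) * n)"
proof -
  let ?A = "SIGMA u:V. {b \<in> carrier_vec n. scales n j u a b}"
  have fin: "finite ?A" by (auto simp: finite_vecs)
  have img: "snd ` ?A = {b \<in> carrier_vec n. \<exists>u\<in>V. scales n j u a b}" by force
  have "card ?A = card (snd ` ?A) * q ^ (l - j)"
  proof (rule card_eq_mult_card_image[OF fin])
    fix b assume "b \<in> snd ` ?A"
    then obtain u where u: "u \<in> V" "b \<in> carrier_vec n" "scales n j u a b" by auto
    have "bij_betw (\<lambda>v. (v, b)) {v. \<pi> ^ j dvd v - u} {x\<in>?A. snd x = b}"
    proof (rule bij_betwI[where g = fst])
      show "(\<lambda>v. (v, b)) \<in> {v. \<pi> ^ j dvd v - u} \<rightarrow> {x\<in>?A. snd x = b}"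
        using u(2) V[OF u(1)] by (intro funcsetI) (simp add: scales_unique[OF u(3) a])
      show "fst \<in> {x\<in>?A. snd x = b} \<rightarrow> {v. \<pi> ^ j dvd v - u}"
        by (intro funcsetI) (auto simp: scales_unique[OF u(3) a])
    qed auto
    from bij_betw_same_card[OF this] show "card {x\<in>?A. snd x = b} = q ^ (l - j)"
      by (simp add: card_coset)
  qed
  moreover have "card ?A = card V * q ^ ((l - j) * n)"
    by (subst card_SigmaI) (auto simp: finite_vecs card_scales)
  ultimately show ?thesis by (simp add: img)
qed

lemma card_vcong:
  assumes "a \<in> unimodular_vecs n" "0 < j"
  shows "card {b \<in> unimodular_vecs n. vcong n j a b} = q ^ ((l - j) * n)"
proof -
  have "{b \<in> unimodular_vecs n. vcong n j a b} = {b \<in> carrier_vec n. scales n j 1 a b}"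
    using scales_unimodular[OF _ assms(2,1)] not_pi_dvd_one
    by (auto simp: vcong_iff_scales) (simp add: unimodular_vecs_def)
  then show ?thesis by (simp add: card_scales)
qed

text \<open>The instance where the multipliers are all units; \<open>j > 0\<close> makes the unit
  group a union of cosets of (\<pi>^j).\<close>

lemma card_vprop:
  assumes "a \<in> unimodular_vecs n" "0 < j"
  shows "card {b \<in> unimodular_vecs n. vprop n j a b} * q ^ (l - j) =
    q ^ (l - 1) * (q - 1) * q ^ ((l - j) * n)"
proof -
  have "{b \<in> unimodular_vecs n. vprop n j a b} =
      {b \<in> carrier_vec n. \<exists>u\<in>{u. u dvd 1}. scales n j u a b}"
  proof (intro equalityI subsetI)
    fix b assume "b \<in> {b \<in> unimodular_vecs n. vprop n j a b}"
    then show "b \<in> {b \<in> carrier_vec n. \<exists>u\<in>{u. u dvd 1}. scales n j u a b}"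
      using scales_unit[OF _ assms(2), of n _ a b]
      by (auto simp: vprop_def unit_iff unimodular_iff)
  next
    fix b assume "b \<in> {b \<in> carrier_vec n. \<exists>u\<in>{u. u dvd 1}. scales n j u a b}"
    then obtain u where u: "b \<in> carrier_vec n" "u dvd 1" "scales n j u a b" by blast
    then have "b \<in> unimodular_vecs n"
      using scales_unimodular[OF u(3) assms(2,1) u(1)] unit_iff by blast
    with u show "b \<in> {b \<in> unimodular_vecs n. vprop n j a b}" by (auto simp: vprop_def)
  qed
  moreover have "v dvd 1" if "u dvd 1" "\<pi> ^ j dvd v - u" for u v :: 'a
  proof (rule ccontr)
    assume "\<not> v dvd 1"
    then have "\<pi> dvd v" using unit_iff by blast
    then have "\<pi> dvd v - (v - u)" using pi_dvd_if_power[OF assms(2) that(2)] by (rule dvd_diff)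
    then show False using that(1) unit_iff[of u] by simp
  qed
  ultimately show ?thesis
    using card_scales_some[OF assms(1), of "{u. u dvd 1}" j] by (simp add: card_units)
qed

text \<open>A multiplier modulo \<pi>^(j+1) is compatible with congruence modulo \<pi>^j exactly if
  it is 1 modulo \<pi>^j. These multipliers fill q cosets of (\<pi>^(j+1)), which accounts for the
  \<open>+ 1\<close> in the exponent.\<close>

lemma card_vcong_vprop:
  assumes a: "a \<in> unimodular_vecs n" and j: "0 < j" "j < l"
  shows "card {b \<in> unimodular_vecs n. vcong n j a b \<and> vprop n (Suc j) a b} = q ^ ((l - Suc j) * n + 1)"
proof -
  have unit: "\<not> \<pi> dvd u" if "\<pi> ^ j dvd u - 1" for u
    using pi_dvd_if_power[OF j(1) that] not_pi_dvd_one dvd_diff[of \<pi> u "u - 1"] by auto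
  have "{b \<in> unimodular_vecs n. vcong n j a b \<and> vprop n (Suc j) a b} =
      {b \<in> carrier_vec n. \<exists>u\<in>{u. \<pi> ^ j dvd u - 1}. scales n (Suc j) u a b}"
  proof (intro equalityI subsetI)
    fix b assume b: "b \<in> {b \<in> unimodular_vecs n. vcong n j a b \<and> vprop n (Suc j) a b}"
    then obtain u where u: "scales n (Suc j) u a b" by (auto simp: vprop_def)
    then have "\<pi> ^ j dvd u - 1"
      using scales_unique[of n j 1 a b u] b a scales_mono[of j "Suc j" n u a b]
      by (auto simp: vcong_iff_scales)
    with u b show "b \<in> {b \<in> carrier_vec n. \<exists>u\<in>{u. \<pi> ^ j dvd u - 1}. scales n (Suc j) u a b}"
      by (auto simp: unimodular_vecs_def)
  next
    fix b assume "b \<in> {b \<in> carrier_vec n. \<exists>u\<in>{u. \<pi> ^ j dvd u - 1}. scales n (Suc j) u a b}"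
    then obtain u where u: "b \<in> carrier_vec n" "\<pi> ^ j dvd u - 1" "scales n (Suc j) u a b" by auto
    have "b \<in> unimodular_vecs n"
      using scales_unimodular[OF u(3) _ a u(1) unit[OF u(2)]] by simp
    moreover have "vcong n j a b"
      using scales_unique[of n j u a b 1] scales_mono[of j "Suc j"] u a
      by (simp add: vcong_iff_scales dvd_diff_swap)
    ultimately show "b \<in> {b \<in> unimodular_vecs n. vcong n j a b \<and> vprop n (Suc j) a b}"
      using u by (auto simp: vprop_def)
  qed
  moreover have "v \<in> {u. \<pi> ^ j dvd u - 1}" if "u \<in> {u. \<pi> ^ j dvd u - 1}" "\<pi> ^ Suc j dvd v - u" for u v
    using that dvd_add[of "\<pi> ^ j" "v - u" "u - 1"] pi_power_dvd_mono[of j "Suc j" "v - u"] by simp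
  ultimately have "card {b \<in> unimodular_vecs n. vcong n j a b \<and> vprop n (Suc j) a b} * q ^ (l - Suc j) =
      q ^ (l - j) * q ^ ((l - Suc j) * n)"
    using card_scales_some[OF a, of "{u. \<pi> ^ j dvd u - 1}" "Suc j"] by (simp add: card_coset)
  also have "\<dots> = q ^ ((l - Suc j) * n + 1) * q ^ (l - Suc j)"
  proof -
    have "l - j = Suc (l - Suc j)" using j(2) by simp
    then show ?thesis by (simp add: power_add)
  qed
  finally show ?thesis using q_ge_3 by simp
qed

text \<open>If \<open>b \<equiv> u a\<close> modulo a maximal power \<open>\<pi>\<^sup>j\<close>, write \<open>b = u a + \<pi>\<^sup>j c\<close>.  Then \<open>a\<close> and \<open>c\<close> are
  independent modulo \<open>\<pi>\<close>, so some 2-by-2 minor of \<open>(a, c)\<close> is a unit and \<open>x \<mapsto> (a \<bullet> x, c \<bullet> x)\<close> is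
  onto.\<close>

lemma scalar_prod_pair_image:
  assumes a: "a \<in> unimodular_vecs n" and b: "b \<in> unimodular_vecs n"
    and jl: "j \<le> l" and u: "scales n j u a b" and max: "j < l \<longrightarrow> \<not> vprop n (Suc j) a b"
  shows "(\<lambda>x. (a \<bullet> x, b \<bullet> x)) ` pi_vecs n e =
    (\<lambda>(s, t). (s, u * s + t)) ` ({s. \<pi> ^ e dvd s} \<times> {t. \<pi> ^ (j + e) dvd t})"
proof -
  have "\<forall>i<n. \<exists>d. b $ i - u * a $ i = \<pi> ^ j * d"
    using u by (auto simp: scales_def dvd_def)
  then obtain d where d: "\<And>i. i < n \<Longrightarrow> b $ i - u * a $ i = \<pi> ^ j * d i" by metis
  define c where "c = vec n d"
  have carr: "a \<in> carrier_vec n" "b \<in> carrier_vec n" "c \<in> carrier_vec n"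
    using a b by (auto simp: unimodular_vecs_def c_def)
  have bc: "b $ i = u * a $ i + \<pi> ^ j * c $ i" if "i < n" for i
    using d[OF that] that by (simp add: c_def algebra_simps)
  have bx: "b \<bullet> x = u * (a \<bullet> x) + \<pi> ^ j * (c \<bullet> x)" if "x \<in> carrier_vec n" for x
    unfolding scalar_prod_def using that
    by (auto simp: bc algebra_simps sum.distrib sum_distrib_left intro!: sum.cong)
  have dvd: "\<pi> ^ e dvd v \<bullet> x" if "x \<in> pi_vecs n e" for v x
    unfolding scalar_prod_def using that by (auto simp: pi_vecs_def intro!: dvd_sum)
  obtain i where i: "i < n" "a $ i dvd 1" using a by (auto simp: unimodular_iff unit_iff)
  then obtain w where w: "a $ i * w = 1" by (metis dvdE)
  show ?thesis
  proof (intro equalityI subsetI)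
    fix p assume "p \<in> (\<lambda>x. (a \<bullet> x, b \<bullet> x)) ` pi_vecs n e"
    then obtain x where x: "x \<in> pi_vecs n e" "p = (a \<bullet> x, b \<bullet> x)" by auto
    then have "p = (a \<bullet> x, u * (a \<bullet> x) + \<pi> ^ j * (c \<bullet> x))" using bx by (auto simp: pi_vecs_def)
    moreover have "\<pi> ^ (j + e) dvd \<pi> ^ j * (c \<bullet> x)"
      using mult_dvd_mono[OF dvd_refl dvd[OF x(1), of c]] by (simp add: power_add)
    ultimately show "p \<in> (\<lambda>(s, t). (s, u * s + t)) ` ({s. \<pi> ^ e dvd s} \<times> {t. \<pi> ^ (j + e) dvd t})"
      using dvd[OF x(1), of a] by (auto intro!: image_eqI[of _ _ "(a \<bullet> x, \<pi> ^ j * (c \<bullet> x))"])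
  next
    fix p assume "p \<in> (\<lambda>(s, t). (s, u * s + t)) ` ({s. \<pi> ^ e dvd s} \<times> {t. \<pi> ^ (j + e) dvd t})"
    then obtain s t where st: "p = (s, u * s + t)" "\<pi> ^ e dvd s" "\<pi> ^ (j + e) dvd t" by auto
    obtain r where "t = \<pi> ^ (j + e) * r" using st(3) by (auto elim: dvdE)
    \<comment> \<open>The cofactor must itself be divisible by \<open>\<pi> ^ e\<close>, so that the
      solution built below stays in \<open>pi_vecs n e\<close>.\<close>
    then obtain t' where t': "t = \<pi> ^ j * t'" "\<pi> ^ e dvd t'"
      by (metis dvd_triv_left mult.assoc power_add)
    have "\<exists>x\<in>pi_vecs n e. a \<bullet> x = s \<and> \<pi> ^ j * (c \<bullet> x) = t"
    proof (cases "j < l")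
      case True
      \<comment> \<open>If every minor through the unit entry \<open>a $ i\<close> vanished modulo
        \<pi>, then \<open>c\<close> would be \<open>w * c $ i\<close> times \<open>a\<close> modulo
        \<pi>. Absorbing this into the multiplier \<open>u\<close> would make \<open>a\<close> and
        \<open>b\<close> proportional modulo one more power.\<close>
      have "\<exists>k<n. \<not> \<pi> dvd a $ i * c $ k - a $ k * c $ i"
      proof (rule ccontr)
        assume "\<not> ?thesis"
        then have all: "\<pi> dvd a $ i * c $ k - a $ k * c $ i" if "k < n" for k using that by blast
        have "scales n (Suc j) (u + \<pi> ^ j * (w * c $ i)) a b"
          unfolding scales_def
        proof (intro allI impI)
          fix k assume k: "k < n"
          have "b $ k - (u + \<pi> ^ j * (w * c $ i)) * a $ k =
              \<pi> ^ j * (c $ k - w * c $ i * a $ k)"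
            by (simp add: bc[OF k] algebra_simps)
          also have "c $ k - w * c $ i * a $ k = (a $ i * w) * c $ k - w * c $ i * a $ k"
            using w by simp
          also have "\<dots> = w * (a $ i * c $ k - a $ k * c $ i)" by (simp add: algebra_simps)
          finally have eq: "b $ k - (u + \<pi> ^ j * (w * c $ i)) * a $ k =
            \<pi> ^ j * (w * (a $ i * c $ k - a $ k * c $ i))" .
          show "\<pi> ^ Suc j dvd b $ k - (u + \<pi> ^ j * (w * c $ i)) * a $ k"
            unfolding eq power_Suc2 using all[OF k] by (intro mult_dvd_mono) auto
        qed
        then show False using max True by (auto simp: vprop_def)
      qed
      then obtain k where k: "k < n" "a $ i * c $ k - a $ k * c $ i dvd 1" using unit_iff by blast
      obtain z where z: "(a $ i * c $ k - a $ k * c $ i) * z = 1" using k(2) by (metis dvdE)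
      have "i \<noteq> k" using z by (auto simp: mult.commute)
      \<comment> \<open>Cramer's rule in the coordinates \<open>i\<close> and \<open>k\<close>;
        \<open>z\<close> inverts the determinant.\<close>
      define x where "x = vec n (\<lambda>m. if m = i then (s * c $ k - t' * a $ k) * z
        else if m = k then (a $ i * t' - c $ i * s) * z else 0)"
      have "x \<in> pi_vecs n e"
        using st(2) t'(2) by (auto simp: x_def pi_vecs_def intro!: dvd_diff dvd_mult2 dvd_mult)
      moreover have "a \<bullet> x = ((a $ i * c $ k - a $ k * c $ i) * z) * s"
        unfolding x_def scalar_prod_two_entries[OF i(1) k(1) \<open>i \<noteq> k\<close>] by (simp add: algebra_simps)
      moreover have "c \<bullet> x = ((a $ i * c $ k - a $ k * c $ i) * z) * t'"
        unfolding x_def scalar_prod_two_entries[OF i(1) k(1) \<open>i \<noteq> k\<close>] by (simp add: algebra_simps)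
      ultimately show ?thesis using z t'(1) by auto
    next
      case False
      \<comment> \<open>At level \<open>l\<close> the second equation reads 0 = 0, and one unit
        entry of \<open>a\<close> solves the first.\<close>
      then have "\<pi> ^ j = 0" using jl pi_power_l by simp
      define x where "x = vec n (\<lambda>m. if m = i then w * s else 0)"
      have "x \<in> pi_vecs n e" using st(2) by (auto simp: x_def pi_vecs_def)
      moreover have "a \<bullet> x = (a $ i * w) * s"
        unfolding x_def scalar_prod_one_entry[OF i(1)] by (simp add: algebra_simps)
      ultimately show ?thesis using w \<open>\<pi> ^ j = 0\<close> t'(1) by auto
    qed
    then obtain x where x: "x \<in> pi_vecs n e" "a \<bullet> x = s" "\<pi> ^ j * (c \<bullet> x) = t" by blast
    then have "p = (a \<bullet> x, b \<bullet> x)" using bx[of x] st(1) by (auto simp: pi_vecs_def)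
    then show "p \<in> (\<lambda>x. (a \<bullet> x, b \<bullet> x)) ` pi_vecs n e" using x(1) by blast
  qed
qed

text \<open>Nonempty fibres of an additive map are translates of its kernel.\<close>

lemma card_fibre:
  assumes a: "a \<in> carrier_vec n" and b: "b \<in> carrier_vec n"
    and y: "y \<in> (\<lambda>x. (a \<bullet> x, b \<bullet> x)) ` pi_vecs n e"
  shows "card {x \<in> pi_vecs n e. (a \<bullet> x, b \<bullet> x) = y} = card {x \<in> pi_vecs n e. a \<bullet> x = 0 \<and> b \<bullet> x = 0}"
proof -
  obtain x0 where x0: "x0 \<in> pi_vecs n e" "y = (a \<bullet> x0, b \<bullet> x0)" using y by auto
  have carr: "x \<in> carrier_vec n" if "x \<in> pi_vecs n e" for x using that by (simp add: pi_vecs_def)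
  have "bij_betw (\<lambda>x. x + x0) {x \<in> pi_vecs n e. a \<bullet> x = 0 \<and> b \<bullet> x = 0}
      {x \<in> pi_vecs n e. (a \<bullet> x, b \<bullet> x) = y}"
  proof (rule bij_betwI[where g = "\<lambda>x. x - x0"])
    show "(\<lambda>x. x + x0) \<in> {x \<in> pi_vecs n e. a \<bullet> x = 0 \<and> b \<bullet> x = 0} \<rightarrow>
        {x \<in> pi_vecs n e. (a \<bullet> x, b \<bullet> x) = y}"
      using x0 a b by (auto simp: pi_vecs_def scalar_prod_add_distrib[of _ n])
    show "(\<lambda>x. x - x0) \<in> {x \<in> pi_vecs n e. (a \<bullet> x, b \<bullet> x) = y} \<rightarrow>
        {x \<in> pi_vecs n e. a \<bullet> x = 0 \<and> b \<bullet> x = 0}"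
      using x0 a b by (auto simp: pi_vecs_def scalar_prod_minus_distrib[of _ n])
    show "x + x0 - x0 = x" if "x \<in> {x \<in> pi_vecs n e. a \<bullet> x = 0 \<and> b \<bullet> x = 0}" for x
      using that carr[of x] carr[OF x0(1)] by (intro eq_vecI) auto
    show "x - x0 + x0 = x" if "x \<in> {x \<in> pi_vecs n e. (a \<bullet> x, b \<bullet> x) = y}" for x
      using that carr[of x] carr[OF x0(1)] by (intro eq_vecI) auto
  qed
  from bij_betw_same_card[OF this] show ?thesis by simp
qed

text \<open>Image size times kernel size is the size of the domain. It is applied with
  \<open>e = 0\<close> for all vectors and \<open>e = 1\<close> for those that fail to be
  unimodular.\<close>

lemma card_orthogonal_pi_vecs:
  assumes a: "a \<in> unimodular_vecs n" and b: "b \<in> unimodular_vecs n"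
    and jl: "j \<le> l" and u: "scales n j u a b" and max: "j < l \<longrightarrow> \<not> vprop n (Suc j) a b"
  shows "q ^ (l - e) * q ^ (l - (j + e)) * card {x \<in> pi_vecs n e. a \<bullet> x = 0 \<and> b \<bullet> x = 0} =
    q ^ ((l - e) * n)"
proof -
  have carr: "a \<in> carrier_vec n" "b \<in> carrier_vec n" using a b by (auto simp: unimodular_vecs_def)
  have "inj_on (\<lambda>(s, t). (s, u * s + t)) ({s. \<pi> ^ e dvd s} \<times> {t. \<pi> ^ (j + e) dvd t})"
    by (auto simp: inj_on_def)
  then have "card ((\<lambda>x. (a \<bullet> x, b \<bullet> x)) ` pi_vecs n e) = q ^ (l - e) * q ^ (l - (j + e))"
    unfolding scalar_prod_pair_image[OF a b jl u max]
    by (simp add: card_image card_cartesian_product card_pi_power)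
  then show ?thesis
    using card_eq_mult_card_image[OF finite_vecs(2) card_fibre[OF carr, where e = e]]
    by (simp add: card_pi_vecs)
qed

end

section \<open>The graphs \<open>Um\<close>\<close>

lemma parity_cases:
  obtains "i = 0" | "i = 1" | k where "0 < k" "i = 2 * k" | k where "0 < k" "i = 2 * k + (1::nat)"
proof -
  obtain k where "i = 2 * k \<or> i = 2 * k + 1" by (metis evenE oddE)
  then show ?thesis using that by (cases "k = 0") auto
qed

text \<open>The common neighbour kernel determines only squares of eigenvalues; the two signs are
  the two square roots.\<close>

lemma plus_minus_eq: "plus_minus S = {\<mu>. \<exists>r\<in>S. \<mu>\<^sup>2 = of_real (r\<^sup>2)}"
proof -
  have "\<mu>\<^sup>2 = of_real (r\<^sup>2) \<longleftrightarrow> \<mu> = of_real r \<or> \<mu> = of_real (- r)" for \<mu> :: complex and r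
    by (simp add: power2_eq_iff)
  then show ?thesis unfolding plus_minus_def by auto
qed

lemma plus_minus_Un_zero:
  "plus_minus (S \<union> (if P then {} else {0})) = plus_minus S \<union> (if P then {} else {0})"
  unfolding plus_minus_def by auto

lemma powr_square:
  assumes "0 < (x::real)" "2 * y = real k"
  shows "(x powr y)\<^sup>2 = x ^ k"
  using assms by (simp add: power2_eq_square flip: powr_add powr_realpow)

context uniformizer
begin

lemma q_real: "0 < real q" "1 < real q"
  using q_ge_3 by auto

text \<open>Hence a common neighbour count in Um is a fibre count over all vectors.\<close>

lemma unimodular_if_scalar_prod_one:
  assumes "z \<in> carrier_vec n" "a \<bullet> z = (1::'a)"
  shows "z \<in> unimodular_vecs n"
proof (rule ccontr)
  assume "z \<notin> unimodular_vecs n"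
  then have "\<pi> dvd a \<bullet> z"
    using assms(1) unfolding scalar_prod_def by (intro dvd_sum) (auto simp: unimodular_iff)
  then show False using assms(2) not_pi_dvd_one by simp
qed

section \<open>The chain of relations for Um\<close>

definition um_rel :: "nat \<Rightarrow> nat \<Rightarrow> 'a vec \<Rightarrow> 'a vec \<Rightarrow> bool" where
  "um_rel n i a b \<longleftrightarrow>
     vcong n (i div 2) a b \<and> (odd i \<longrightarrow> vprop n (Suc (i div 2)) a b)"

text \<open>For k < l, the relation at 2k minus the one at 2k+1 singles out the pairs congruent
  modulo \<pi>^k whose level is exactly k; such a pair has q^((n-2)l+k) common neighbours. The last
  index 2l is equality and has no odd partner.\<close>

definition um_coeff :: "nat \<Rightarrow> nat \<Rightarrow> real" where
  "um_coeff n i = (if even i then 1 else - 1) * real q ^ ((n - 2) * l + i div 2)"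

text \<open>The first two sizes break the pattern: at 0 nothing is imposed beyond unimodularity, and
  at 1 the multipliers range over all units instead of a coset of 1.\<close>

definition um_size :: "nat \<Rightarrow> nat \<Rightarrow> nat" where
  "um_size n i =
     (if i = 0 then q ^ (l * n) - q ^ ((l - 1) * n)
      else if i = 1 then (q - 1) * q ^ ((l - 1) * n)
      else if even i then q ^ ((l - i div 2) * n)
      else q ^ ((l - Suc (i div 2)) * n + 1))"

text \<open>The image consists of the pairs (s, u s + t) with t divisible by \<pi>^j; hitting (1,1)
  forces t = 1 - u, so 1 must also be a multiplier from \<open>a\<close> to
  \<open>b\<close>.\<close>

lemma one_one_mem_image_iff:
  assumes a: "a \<in> unimodular_vecs n" and b: "b \<in> unimodular_vecs n"
    and jl: "j \<le> l" and u: "scales n j u a b" and max: "j < l \<longrightarrow> \<not> vprop n (Suc j) a b"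
  shows "(1, 1) \<in> (\<lambda>x. (a \<bullet> x, b \<bullet> x)) ` pi_vecs n 0 \<longleftrightarrow> vcong n j a b"
proof -
  have "(1, 1) \<in> (\<lambda>(s, t). (s, u * s + t)) ` (UNIV \<times> {t. \<pi> ^ j dvd t}) \<longleftrightarrow> \<pi> ^ j dvd 1 - u"
  proof
    assume "(1, 1) \<in> (\<lambda>(s, t). (s, u * s + t)) ` (UNIV \<times> {t. \<pi> ^ j dvd t})"
    then obtain t where t: "\<pi> ^ j dvd t" "1 = u + t" by force
    from t(2) have "1 - u = t" by (metis add_diff_cancel_left')
    with t(1) show "\<pi> ^ j dvd 1 - u" by simp
  next
    assume "\<pi> ^ j dvd 1 - u"
    then show "(1, 1) \<in> (\<lambda>(s, t). (s, u * s + t)) ` (UNIV \<times> {t. \<pi> ^ j dvd t})"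
      by (intro image_eqI[of _ _ "(1, 1 - u)"]) simp_all
  qed
  then show ?thesis
    using scalar_prod_pair_image[OF a b jl u max, of 0] scales_unique[OF u a, of 1]
    by (simp add: vcong_iff_scales)
qed

text \<open>A fibre over (1,1) is empty or as large as the kernel, whose exponent is ln - l - (l-j)
  = (n-2)l + j.\<close>

lemma card_um_common_neighbours:
  assumes a: "a \<in> unimodular_vecs n" and b: "b \<in> unimodular_vecs n" and n: "2 \<le> n"
    and jl: "j \<le> l" and u: "scales n j u a b" and max: "j < l \<longrightarrow> \<not> vprop n (Suc j) a b"
  shows "card {z \<in> unimodular_vecs n. a \<bullet> z = 1 \<and> b \<bullet> z = 1} =
    (if vcong n j a b then q ^ ((n - 2) * l + j) else 0)"
proof -
  have carr: "a \<in> carrier_vec n" "b \<in> carrier_vec n" using a b by (auto simp: unimodular_vecs_def)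
  obtain p where p: "n = Suc (Suc p)" using n by (metis add_2_eq_Suc le_Suc_ex)
  let ?N = "{z \<in> unimodular_vecs n. a \<bullet> z = 1 \<and> b \<bullet> z = 1}"
  have N: "?N = {x \<in> pi_vecs n 0. (a \<bullet> x, b \<bullet> x) = (1, 1)}"
    using unimodular_if_scalar_prod_one[of _ n a] by (auto simp: pi_vecs_def unimodular_vecs_def)
  note img = one_one_mem_image_iff[OF a b jl u max]
  show ?thesis
  proof (cases "vcong n j a b")
    case True
    have "card ?N = card {x \<in> pi_vecs n 0. a \<bullet> x = 0 \<and> b \<bullet> x = 0}"
      unfolding N by (rule card_fibre[OF carr]) (simp only: img True)
    then have "q ^ l * q ^ (l - j) * card ?N = q ^ (l * n)"
      using card_orthogonal_pi_vecs[OF a b jl u max, of 0] by simp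
    moreover have "l * n = l + (l - j) + ((n - 2) * l + j)"
      using jl by (simp add: p)
    ultimately have "q ^ l * q ^ (l - j) * card ?N = q ^ l * q ^ (l - j) * q ^ ((n - 2) * l + j)"
      by (simp only: power_add)
    then have "card ?N = q ^ ((n - 2) * l + j)" using q_ge_3 by simp
    then show ?thesis using True by simp
  next
    case False
    then have "(1, 1) \<notin> (\<lambda>x. (a \<bullet> x, b \<bullet> x)) ` pi_vecs n 0" using img by simp
    then have "?N = {}"
      unfolding N by (metis (mono_tags, lifting) empty_Collect_eq image_eqI)
    then show ?thesis using False by (simp only: card.empty if_False)
  qed
qed

lemma um_common_neighbours:
  assumes a: "a \<in> unimodular_vecs n" and b: "b \<in> unimodular_vecs n" and n: "2 \<le> n"
  shows "real (card {z \<in> unimodular_vecs n. a \<bullet> z = 1 \<and> b \<bullet> z = 1}) =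
    (\<Sum>i\<le>2 * l. if um_rel n i a b then um_coeff n i else 0)"
proof -
  have split: "(\<Sum>i\<le>2 * m. f i) = (\<Sum>j<m. f (2 * j) + f (2 * j + 1)) + f (2 * m)"
    for m and f :: "nat \<Rightarrow> real"
    by (induction m) auto
  obtain j where j: "j \<le> l" "\<And>i. i \<le> l \<Longrightarrow> vprop n i a b \<longleftrightarrow> i \<le> j"
    using ex_vprop_level[of n a b] by blast
  obtain u where u: "scales n j u a b" using j by (auto simp: vprop_def)
  have max: "j < l \<longrightarrow> \<not> vprop n (Suc j) a b" using j(2)[of "Suc j"] by auto
  have le: "i \<le> j" if "vcong n i a b" "i \<le> l" for i
    using vcong_imp_vprop[OF that(1)] j(2)[OF that(2)] by simp
  \<comment> \<open>The pair of terms cancels unless \<open>i = j\<close>: below the level,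
    proportionality modulo the next power is automatic, and above the level congruence
    fails.\<close>
  have "(if um_rel n (2 * i) a b then um_coeff n (2 * i) else 0) +
      (if um_rel n (2 * i + 1) a b then um_coeff n (2 * i + 1) else 0) =
      (if i = j \<and> vcong n j a b then real q ^ ((n - 2) * l + j) else 0)" if "i < l" for i
  proof (cases "i = j")
    case True
    then show ?thesis using j(2)[of "Suc j"] that by (simp add: um_rel_def um_coeff_def)
  next
    case False
    then have "vcong n i a b \<Longrightarrow> vprop n (Suc i) a b"
      using le[of i] j(2)[of "Suc i"] that by simp
    then show ?thesis using False by (auto simp: um_rel_def um_coeff_def)
  qed
  then have "(\<Sum>i\<le>2 * l. if um_rel n i a b then um_coeff n i else 0) =
      (\<Sum>i<l. if i = j \<and> vcong n j a b then real q ^ ((n - 2) * l + j) else 0) +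
      (if vcong n l a b then real q ^ ((n - 2) * l + l) else 0)"
    unfolding split by (simp add: um_rel_def um_coeff_def)
  moreover have "\<dots> = (if vcong n j a b then real q ^ ((n - 2) * l + j) else 0)"
  proof (cases "j = l")
    case False
    then have "\<not> vcong n l a b" using le[of l] j(1) by auto
    then show ?thesis using False j(1) by (cases "vcong n j a b") simp_all
  qed simp
  moreover have "real (card {z \<in> unimodular_vecs n. a \<bullet> z = 1 \<and> b \<bullet> z = 1}) =
      (if vcong n j a b then real q ^ ((n - 2) * l + j) else 0)"
    unfolding card_um_common_neighbours[OF a b n j(1) u max] by simp
  ultimately show ?thesis by (simp only:)
qed

text \<open>Indices 1 and 2 are separated by q - 1 > 1; an even index 2k > 0 and its odd successor
  are separated because n > 1.\<close>

lemma um_size_strict: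
  assumes n: "2 \<le> n" and i: "i < 2 * l"
  shows "um_size n i \<noteq> um_size n (Suc i)"
proof -
  have q: "1 < q" "0 < q" using q_ge_3 by auto
  show ?thesis
  proof (cases i rule: parity_cases)
    case 1
    define B where "B = q ^ ((l - 1) * n)"
    have "l * n = n + (l - 1) * n" using l_pos by (cases l) auto
    then have ln: "q ^ (l * n) = q ^ n * B" by (simp only: power_add B_def)
    have "q ^ 1 < q ^ n" using q n by (intro power_strict_increasing) auto
    then have "(q - 1) * B < (q ^ n - 1) * B" using q by (auto simp: B_def)
    moreover have "um_size n 0 = (q ^ n - 1) * B"
      unfolding um_size_def ln B_def[symmetric] by (simp add: diff_mult_distrib)
    moreover have "um_size n (Suc 0) = (q - 1) * B" unfolding um_size_def B_def by simp
    ultimately show ?thesis using 1 by simp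
  next
    case 2
    then show ?thesis using q_ge_3 by (auto simp: um_size_def)
  next
    case (3 k)
    have "l - k = Suc (l - Suc k)" using 3 i by simp
    then have "(l - k) * n \<noteq> (l - Suc k) * n + 1" using n by simp
    then have "q ^ ((l - k) * n) \<noteq> q ^ ((l - Suc k) * n + 1)" using q(1) power_inject_exp by blast
    then show ?thesis using 3 by (simp add: um_size_def)
  next
    case (4 k)
    then show ?thesis using q by (auto simp: um_size_def)
  qed
qed

text \<open>Once the half index grows, the finer congruence already contains the proportionality
  that an odd \<open>i\<close> demands.\<close>

lemma um_rel_mono:
  assumes "i \<le> j" "um_rel n j a b"
  shows "um_rel n i a b"
proof (cases "i div 2 = j div 2")
  case True
  then have "odd i \<Longrightarrow> odd j" using assms(1) by presburger
  then show ?thesis using True assms(2) by (auto simp: um_rel_def)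
next
  case False
  then have "i div 2 < j div 2" using assms(1) by (simp add: div_le_mono le_neq_implies_less)
  moreover have "vcong n (j div 2) a b" using assms(2) by (simp add: um_rel_def)
  ultimately show ?thesis
    using vcong_mono[of "i div 2" "j div 2" n a b] vprop_mono[of "Suc (i div 2)" "j div 2" n a b]
      vcong_imp_vprop by (simp add: um_rel_def)
qed

lemma card_um_rel:
  assumes "a \<in> unimodular_vecs n" "i \<le> 2 * l"
  shows "card {b \<in> unimodular_vecs n. um_rel n i a b} = um_size n i"
proof -
  show ?thesis
  proof (cases i rule: parity_cases)
    case 1
    then show ?thesis using card_unimodular[of n] by (simp add: um_rel_def um_size_def vcong_0)
  next
    case 2
    then show ?thesis using card_vprop[OF assms(1), of 1] q_ge_3 l_pos
      by (simp add: um_rel_def um_size_def vcong_0 mult.commute mult.left_commute)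
  next
    case (3 k)
    then show ?thesis using card_vcong[OF assms(1), of k] by (simp add: um_rel_def um_size_def)
  next
    case (4 k)
    then show ?thesis using card_vcong_vprop[OF assms(1), of k] assms(2)
      by (simp add: um_rel_def um_size_def)
  qed
qed

lemma unit_vec_unimodular: "0 < n \<Longrightarrow> (unit_vec n 0 :: 'a vec) \<in> unimodular_vecs n"
  unfolding unimodular_iff using not_pi_dvd_one by (intro conjI exI[of _ 0]) simp_all

lemma um_chain:
  assumes n: "2 \<le> n"
  shows "uniform_chain (unimodular_vecs n) (um_rel n) (2 * l) (um_size n)"
proof
  show "finite (unimodular_vecs n :: 'a vec set)" by (rule finite_vecs)
  show "unimodular_vecs n \<noteq> ({} :: 'a vec set)" using unit_vec_unimodular[of n] n by auto
  fix i j and x y z :: "'a vec"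
  assume x: "x \<in> unimodular_vecs n"
  show "um_rel n i x x" by (simp add: um_rel_def vcong_refl vprop_refl)
  show "card {y \<in> unimodular_vecs n. um_rel n i x y} = um_size n i" if "i \<le> 2 * l"
    using card_um_rel[OF x that] .
  assume y: "y \<in> unimodular_vecs n"
  show "um_rel n i y x" if "um_rel n i x y"
    using that vprop_sym[OF y] vcong_sym by (auto simp: um_rel_def)
  show "um_rel n 0 x y" by (simp add: um_rel_def vcong_0)
  show "x = y" if "um_rel n (2 * l) x y"
    using that x y vcong_l by (auto simp: um_rel_def unimodular_vecs_def)
  show "um_rel n i x y" if "i \<le> j" "um_rel n j x y"
    using um_rel_mono that by blast
  show "um_rel n i x z" if "um_rel n i x y" "um_rel n i y z"
    using that vcong_trans vprop_trans unfolding um_rel_def by blast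
qed (use um_size_strict n in auto)

section \<open>Tail sums giving the squared eigenvalues of Um\<close>

definition um_ev :: "nat \<Rightarrow> nat \<Rightarrow> real" where
  "um_ev n i = (\<Sum>k=i..2 * l. um_coeff n k * real (um_size n k))"

lemma um_ev_step: "i \<le> 2 * l \<Longrightarrow> um_ev n i = um_coeff n i * real (um_size n i) + um_ev n (Suc i)"
  unfolding um_ev_def by (rule sum.atLeast_Suc_atMost)

text \<open>The negative term at 2j+1 cancels the following tail exactly. The value of that tail is
  a hypothesis so that the fact can be used inside the downward induction for the even
  indices.\<close>

lemma um_ev_odd_if:
  assumes "0 < j" "j < l"
    and "um_ev n (2 * Suc j) = real q ^ ((n - 2) * l + Suc j + (l - Suc j) * n)"
  shows "um_ev n (2 * j + 1) = 0"
  using um_ev_step[of "2 * j + 1" n] assms by (simp add: um_coeff_def um_size_def power_add)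

text \<open>Going down from \<open>l\<close>, the odd tail below is zero, so only the term at the
  even index itself remains.\<close>

lemma um_ev_even:
  assumes "0 < j" "j \<le> l"
  shows "um_ev n (2 * j) = real q ^ ((n - 2) * l + j + (l - j) * n)"
  using assms(2,1)
proof (induction rule: inc_induct)
  case base
  then show ?case by (simp add: um_ev_def um_coeff_def um_size_def)
next
  case (step j)
  then show ?case using um_ev_odd_if[of j n] um_ev_step[of "2 * j" n]
    by (simp add: um_coeff_def um_size_def power_add)
qed

lemma um_ev_odd: "0 < j \<Longrightarrow> j < l \<Longrightarrow> um_ev n (2 * j + 1) = 0"
  by (rule um_ev_odd_if) (auto simp: um_ev_even simp del: mult_Suc_right)

text \<open>Here the class size has the factor q - 1 in place of q, so the cancellation seen at
  later odd indices leaves one summand.\<close>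

lemma um_ev_1: "um_ev n 1 = real q ^ ((n - 2) * l + (l - 1) * n)"
proof -
  define A B where "A = (n - 2) * l" and "B = (l - 1) * n"
  have "um_ev n 1 = - (real q ^ A) * ((real q - 1) * real q ^ B) + real q ^ (A + 1 + B)"
    using um_ev_step[of 1 n] um_ev_even[of 1 n] l_pos q_ge_3
    by (simp add: um_coeff_def um_size_def of_nat_diff numeral_2_eq_2 A_def B_def)
  then show ?thesis
    unfolding A_def[symmetric] B_def[symmetric] by (simp add: power_add algebra_simps)
qed

text \<open>The subtracted nonunimodular vectors cancel against the tail at 1. The result is the
  squared degree of the graph.\<close>

lemma um_ev_0: "um_ev n 0 = real q ^ ((n - 2) * l + l * n)"
proof -
  have "q ^ ((l - 1) * n) \<le> q ^ (l * n)" using q_ge_3 by (intro power_increasing) auto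
  then show ?thesis
    using um_ev_step[of 0 n] um_ev_1[of n]
    by (simp add: um_coeff_def um_size_def power_add of_nat_diff algebra_simps)
qed

lemma um_ev_image:
  assumes n: "2 \<le> n"
  shows "um_ev n ` {..2 * l} = (\<lambda>r. r\<^sup>2) `
    ({real q ^ ((n - 1) * l), real q powr ((real n - 1) * real l - real n / 2)}
     \<union> {real q powr ((real n - 1) * (real l - real k / 2)) | k. k \<in> {1..l}}
     \<union> (if l = 1 then {} else {0}))"
proof -
  have e0: "um_ev n 0 = (real q ^ ((n - 1) * l))\<^sup>2"
  proof -
    obtain p where p: "n = Suc (Suc p)" using n by (metis add_2_eq_Suc le_Suc_ex)
    have "(n - 2) * l + l * n = (n - 1) * l * 2" by (simp add: p algebra_simps)
    then show ?thesis by (simp only: um_ev_0 power_mult)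
  qed
  have e1: "um_ev n 1 = (real q powr ((real n - 1) * real l - real n / 2))\<^sup>2"
  proof -
    have "real ((n - 2) * l + (l - 1) * n) = (real n - 2) * real l + (real l - 1) * real n"
      using n l_pos by (simp only: of_nat_add of_nat_mult) (simp add: of_nat_diff Suc_leI)
    then have "2 * ((real n - 1) * real l - real n / 2) = real ((n - 2) * l + (l - 1) * n)"
      by (simp only:) (simp add: field_simps)
    then show ?thesis
      unfolding um_ev_1 by (rule powr_square[OF q_real(1), symmetric])
  qed
  have e2: "um_ev n (2 * k) = (real q powr ((real n - 1) * (real l - real k / 2)))\<^sup>2"
    if "k \<in> {1..l}" for k
  proof -
    have "real ((n - 2) * l + k + (l - k) * n) =
        (real n - 2) * real l + real k + (real l - real k) * real n"
      using n that by (simp only: of_nat_add of_nat_mult) (simp add: of_nat_diff)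
    then have "2 * ((real n - 1) * (real l - real k / 2)) = real ((n - 2) * l + k + (l - k) * n)"
      by (simp only:) (simp add: field_simps)
    moreover have "um_ev n (2 * k) = real q ^ ((n - 2) * l + k + (l - k) * n)"
      using that by (intro um_ev_even) auto
    ultimately show ?thesis
      using powr_square[OF q_real(1)] by metis
  qed
  have dom: "{..2 * l} = {0, 1} \<union> (\<lambda>k. 2 * k) ` {1..l} \<union> (\<lambda>k. 2 * k + 1) ` {1..<l}"
  proof (intro equalityI subsetI)
    fix i assume "i \<in> {..2 * l}"
    then show "i \<in> {0, 1} \<union> (\<lambda>k. 2 * k) ` {1..l} \<union> (\<lambda>k. 2 * k + 1) ` {1..<l}"
      by (cases i rule: parity_cases) auto
  qed (use l_pos in auto)
  \<comment> \<open>The odd indices with zero tail are 2k+1 for 0 < k < l, and they exist exactly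
    when the ring is not a field.\<close>
  have odd: "um_ev n ` (\<lambda>k. 2 * k + 1) ` {1..<l} = (if l = 1 then {} else {0})"
  proof (cases "l = 1")
    case False
    then have "{1..<l} \<noteq> {}" using l_pos by auto
    moreover have "um_ev n ` (\<lambda>k. 2 * k + 1) ` {1..<l} = (\<lambda>_. 0) ` {1..<l}"
      unfolding image_image using um_ev_odd by (intro image_cong) auto
    ultimately show ?thesis using False by (simp add: image_constant_conv)
  qed simp
  have even: "um_ev n ` (\<lambda>k. 2 * k) ` {1..l} =
      (\<lambda>r. r\<^sup>2) ` {real q powr ((real n - 1) * (real l - real k / 2)) | k. k \<in> {1..l}}"
    unfolding image_image Setcompr_eq_image using e2 by (rule image_cong[OF refl])
  show ?thesis
    unfolding dom image_Un even odd using e0 e1 by auto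
qed

lemma um_eigenvalues:
  assumes n: "2 \<le> n"
  shows "adjacency_eigenvalues (Um n :: ('a vec + 'a vec) pair_pre_digraph) =
    plus_minus
      ({real q ^ ((n - 1) * l), real q powr ((real n - 1) * real l - real n / 2)}
       \<union> {real q powr ((real n - 1) * (real l - real k / 2)) | k. k \<in> {1..l}})
    \<union> (if \<forall>x::'a. x \<noteq> 0 \<longrightarrow> x dvd 1 then {} else {0})"
    (is "_ = plus_minus ?S \<union> _")
proof -
  interpret uniform_chain "unimodular_vecs n :: 'a vec set" "um_rel n" "2 * l" "um_size n"
    by (rule um_chain[OF n])
  have "\<mu> \<in> adjacency_eigenvalues (Um n :: ('a vec + 'a vec) pair_pre_digraph) \<longleftrightarrow>
      (\<exists>i\<le>2 * l. \<mu>\<^sup>2 = of_real (um_ev n i))" for \<mu>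
  proof -
    have "(a \<bullet> b = 1) = (b \<bullet> a = 1)" if "a \<in> unimodular_vecs n" "b \<in> unimodular_vecs n"
      for a b :: "'a vec"
      using comm_scalar_prod[of a n b] that by (auto simp: unimodular_vecs_def)
    from bipartite_graph_eigenvalues_iff[OF fin this] show ?thesis
      unfolding Um_def um_ev_def
      by (subst kernel_eigenvalue_iff[symmetric]) (simp_all flip: um_common_neighbours[OF _ _ n])
  qed
  then have "adjacency_eigenvalues (Um n :: ('a vec + 'a vec) pair_pre_digraph) =
      {\<mu>. \<exists>t\<in>um_ev n ` {..2 * l}. \<mu>\<^sup>2 = of_real t}"
    by auto
  also have "\<dots> = plus_minus (?S \<union> (if l = 1 then {} else {0}))"
    unfolding um_ev_image[OF n] plus_minus_eq by blast
  also have "\<dots> = plus_minus ?S \<union> (if l = 1 then {} else {0})"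
    by (rule plus_minus_Un_zero)
  finally show ?thesis unfolding field_iff .
qed

end

section \<open>The graphs \<open>Um0\<close>\<close>

context uniformizer
begin

text \<open>Identifies the relation behind the vertex set of Um0 with the finest proportionality,
  because \<pi>^l = 0 and the multiplier is automatically a unit.\<close>

lemma unit_scaling_eq:
  "unit_scaling n = {(a, b). a \<in> unimodular_vecs n \<and> b \<in> unimodular_vecs n \<and> vprop n l a (b :: 'a vec)}"
proof -
  have "(\<exists>u. u dvd 1 \<and> b = u \<cdot>\<^sub>v a) \<longleftrightarrow> vprop n l a b"
    if a: "a \<in> unimodular_vecs n" and b: "b \<in> unimodular_vecs n" for a b :: "'a vec"
  proof
    assume "\<exists>u. u dvd 1 \<and> b = u \<cdot>\<^sub>v a"
    then obtain u where "b = u \<cdot>\<^sub>v a" by blast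
    then have "scales n l u a b"
      using a by (auto simp: scales_def unimodular_vecs_def)
    then show "vprop n l a b" by (auto simp: vprop_def)
  next
    assume "vprop n l a b"
    then obtain u where u: "scales n l u a b" by (auto simp: vprop_def)
    then have "b = u \<cdot>\<^sub>v a"
      using a b by (intro eq_vecI) (auto simp: scales_def unimodular_vecs_def dvd_zero_power)
    moreover have "u dvd 1" using scales_unit[OF u l_pos b] unit_iff by blast
    ultimately show "\<exists>u. u dvd 1 \<and> b = u \<cdot>\<^sub>v a" by blast
  qed
  then show ?thesis unfolding unit_scaling_def by auto
qed

lemma equiv_unit_scaling: "equiv (unimodular_vecs n) (unit_scaling n :: 'a vec rel)"
  unfolding unit_scaling_eq
proof (rule equivI)
  let ?r = "{(a, b). a \<in> unimodular_vecs n \<and> b \<in> unimodular_vecs n \<and> vprop n l a (b :: 'a vec)}"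
  show "?r \<subseteq> unimodular_vecs n \<times> unimodular_vecs n" by auto
  show "refl_on (unimodular_vecs n) ?r" by (auto simp: refl_on_def vprop_refl)
  show "sym ?r" using vprop_sym by (auto simp: sym_def)
  show "trans ?r" using vprop_trans unfolding trans_def by blast
qed

lemma scaling_class: "a \<in> unimodular_vecs n \<Longrightarrow>
    unit_scaling n `` {a} = {b \<in> unimodular_vecs n. vprop n l a (b :: 'a vec)}"
  by (auto simp: unit_scaling_eq)

lemma card_scaling_class:
  "a \<in> unimodular_vecs n \<Longrightarrow> card (unit_scaling n `` {a :: 'a vec}) = q ^ (l - 1) * (q - 1)"
  using card_vprop[of a n l] l_pos by (simp add: scaling_class)

lemmas card_scaling_quotient =
  card_quotient_filter[OF equiv_unit_scaling finite_vecs(3) card_scaling_class]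

definition class_rel :: "nat \<Rightarrow> nat \<Rightarrow> 'a vec set \<Rightarrow> 'a vec set \<Rightarrow> bool" where
  "class_rel n j A B \<longleftrightarrow> (\<exists>a\<in>A. \<exists>b\<in>B. vprop n j a b)"

lemma class_rel_iff:
  assumes a: "a \<in> unimodular_vecs n" and b: "b \<in> unimodular_vecs n"
  shows "class_rel n j (unit_scaling n `` {a}) (unit_scaling n `` {b}) \<longleftrightarrow> vprop n j a b"
proof
  assume "class_rel n j (unit_scaling n `` {a}) (unit_scaling n `` {b})"
  then obtain a' b' where h: "a' \<in> unimodular_vecs n" "b' \<in> unimodular_vecs n"
    "vprop n l a a'" "vprop n l b b'" "vprop n j a' b'"
    unfolding class_rel_def scaling_class[OF a] scaling_class[OF b] by blast
  show "vprop n j a b"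
    using vprop_trans[OF vprop_trans[OF vprop_l[OF h(3)] h(5)] vprop_sym[OF h(2) vprop_l[OF h(4)]]] .
next
  assume "vprop n j a b"
  then show "class_rel n j (unit_scaling n `` {a}) (unit_scaling n `` {b})"
    unfolding class_rel_def scaling_class[OF a] scaling_class[OF b] using a b vprop_refl by blast
qed

definition class_orth :: "'a vec set \<Rightarrow> 'a vec set \<Rightarrow> bool" where
  "class_orth A B \<longleftrightarrow> (\<exists>a\<in>A. \<exists>b\<in>B. a \<bullet> b = 0)"

lemma class_orth_iff:
  assumes a: "a \<in> unimodular_vecs n" and b: "b \<in> unimodular_vecs n"
  shows "class_orth (unit_scaling n `` {a}) (unit_scaling n `` {b}) \<longleftrightarrow> a \<bullet> b = 0"
proof
  assume "class_orth (unit_scaling n `` {a}) (unit_scaling n `` {b})"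
  then obtain a' b' where h: "(a, a') \<in> unit_scaling n" "(b, b') \<in> unit_scaling n" "a' \<bullet> b' = 0"
    unfolding class_orth_def by blast
  then obtain u v where uv: "u dvd 1" "a' = u \<cdot>\<^sub>v a" "v dvd 1" "b' = v \<cdot>\<^sub>v b"
    unfolding unit_scaling_def by blast
  have "a \<in> carrier_vec n" "b \<in> carrier_vec n" using a b by (auto simp: unimodular_vecs_def)
  then have "(u * v) * (a \<bullet> b) = 0" using h(3) uv by (simp add: ac_simps)
  moreover have "u * v dvd 1" using mult_dvd_mono[OF uv(1,3)] by simp
  then obtain w where "(u * v) * w = 1" by (metis dvdE)
  ultimately show "a \<bullet> b = 0" by (metis mult.commute mult.left_commute mult_1_left mult_zero_right)
next
  assume "a \<bullet> b = 0"
  moreover have "a \<in> unit_scaling n `` {a}" "b \<in> unit_scaling n `` {b}"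
    using a b by (auto simp: unit_scaling_eq vprop_refl)
  ultimately show "class_orth (unit_scaling n `` {a}) (unit_scaling n `` {b})"
    unfolding class_orth_def by blast
qed

text \<open>Vertices are points of a projective space over R; for j > 0 this is the number of points
  with a given reduction modulo \<pi>^j. The total at 0 stays a cardinality because its closed form
  is a quotient.\<close>

definition um0_size :: "nat \<Rightarrow> nat \<Rightarrow> nat" where
  "um0_size n j =
     (if j = 0 then card (unimodular_vecs n // unit_scaling n :: 'a vec set set)
      else q ^ ((l - j) * (n - 1)))"

text \<open>The count of proportional vectors from \<open>card_vprop\<close> is divided by the
  number of vectors in one scaling class.\<close>

lemma card_class_rel:
  assumes n: "0 < n" and A: "A \<in> unimodular_vecs n // unit_scaling n"
  shows "card {B \<in> unimodular_vecs n // unit_scaling n. class_rel n j A B} = um0_size n j"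
proof -
  obtain a where a: "a \<in> unimodular_vecs n" "A = unit_scaling n `` {a}" using A by (rule quotientE)
  show ?thesis
  proof (cases "j = 0")
    case True
    have "class_rel n 0 A B" if "B \<in> unimodular_vecs n // unit_scaling n" for B
      using that a by (auto elim!: quotientE simp: class_rel_iff vprop_0)
    then have "{B \<in> unimodular_vecs n // unit_scaling n. class_rel n 0 A B} =
      unimodular_vecs n // unit_scaling n" by blast
    then show ?thesis using True by (simp add: um0_size_def)
  next
    case False
    let ?Q = "card {B \<in> unimodular_vecs n // unit_scaling n. class_rel n j A B}"
    let ?w = "q ^ (l - 1) * (q - 1)"
    have "{b \<in> unimodular_vecs n. class_rel n j A (unit_scaling n `` {b})} =
        {b \<in> unimodular_vecs n. vprop n j a b}"
      using a by (auto simp: class_rel_iff)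
    then have "?Q * ?w = card {b \<in> unimodular_vecs n. vprop n j a b}"
      using card_scaling_quotient[of n "class_rel n j A"] by simp
    then have "?w * (?Q * q ^ (l - j)) = ?w * q ^ ((l - j) * n)"
      using card_vprop[OF a(1), of j] False by (simp add: ac_simps)
    moreover have "?w \<noteq> 0" using q_ge_3 by simp
    ultimately have "?Q * q ^ (l - j) = q ^ ((l - j) * n)" by (metis mult_left_cancel)
    moreover have "(l - j) * n = (l - j) * (n - 1) + (l - j)" using n by (cases n) auto
    ultimately have "?Q * q ^ (l - j) = q ^ ((l - j) * (n - 1)) * q ^ (l - j)"
      by (simp only: power_add)
    then show ?thesis using False q_ge_3 by (simp add: um0_size_def)
  qed
qed

lemma card_quotient_unimodular:
  "um0_size n 0 * (q ^ (l - 1) * (q - 1)) = q ^ (l * n) - q ^ ((l - 1) * n)"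
  using card_scaling_quotient[of n "\<lambda>_. True"] by (simp add: um0_size_def card_unimodular)

lemma um0_chain:
  assumes n: "2 \<le> n"
  shows "uniform_chain (unimodular_vecs n // unit_scaling n) (class_rel n) l (um0_size n)"
proof
  let ?X = "unimodular_vecs n // unit_scaling n :: 'a vec set set"
  show "finite ?X" by (rule finite_quotient[OF finite_vecs(3)]) (auto simp: unit_scaling_eq)
  show "?X \<noteq> {}" using unit_vec_unimodular[of n] n by (auto simp: quotient_def)
  fix i j and A B C :: "'a vec set"
  assume A: "A \<in> ?X"
  then obtain a where a: "a \<in> unimodular_vecs n" "A = unit_scaling n `` {a}" by (rule quotientE)
  show "class_rel n i A A" using a by (simp add: class_rel_iff vprop_refl)
  show "card {B \<in> ?X. class_rel n i A B} = um0_size n i" using card_class_rel[OF _ A] n by simp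
  assume "B \<in> ?X"
  then obtain b where b: "b \<in> unimodular_vecs n" "B = unit_scaling n `` {b}" by (rule quotientE)
  show "class_rel n i B A" if "class_rel n i A B"
    using that a b vprop_sym by (simp add: class_rel_iff)
  show "class_rel n 0 A B" using a b by (simp add: class_rel_iff vprop_0)
  show "A = B" if "class_rel n l A B"
  proof -
    have "vprop n l a b" using that a b by (simp add: class_rel_iff)
    then have "(a, b) \<in> unit_scaling n" using a b by (simp add: unit_scaling_eq)
    then show ?thesis using equiv_class_eq[OF equiv_unit_scaling] a b by blast
  qed
  show "class_rel n i A B" if "i \<le> j" "class_rel n j A B"
    using that a b vprop_mono by (auto simp: class_rel_iff)
  assume "C \<in> ?X"
  then obtain c where c: "c \<in> unimodular_vecs n" "C = unit_scaling n `` {c}" by (rule quotientE)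
  show "class_rel n i A C" if "class_rel n i A B" "class_rel n i B C"
    using that a b c vprop_trans[of n i a b c] by (simp add: class_rel_iff)
next
  fix i assume i: "i < l"
  have q: "1 < q" using q_ge_3 by auto
  show "um0_size n i \<noteq> um0_size n (Suc i)"
  proof (cases "i = 0")
    case False
    have "(l - i) * (n - 1) \<noteq> (l - Suc i) * (n - 1)" using i n by simp
    then show ?thesis using False q power_inject_exp[OF q] by (simp add: um0_size_def)
  next
    case True
    show ?thesis
    proof
      assume "um0_size n i = um0_size n (Suc i)"
      then have s: "um0_size n 0 = q ^ ((l - 1) * (n - 1))" using True by (simp add: um0_size_def)
      define B where "B = q ^ ((l - 1) * n)"
      have e1: "(l - 1) * n = (l - 1) * (n - 1) + (l - 1)" using n by (cases n) auto
      have e2: "l * n = n + (l - 1) * n" using l_pos by (cases l) auto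
      \<comment> \<open>Equal sizes would make the left side the number of unimodular vectors; the
        right side is the true number.\<close>
      have "B * (q - 1) = q ^ n * B - B"
        using card_quotient_unimodular[of n] unfolding s e2 B_def
        by (simp only: e1 power_add mult.assoc)
      then have "B * (q - 1) = B * (q ^ n - 1)" by (simp add: algebra_simps)
      then have "q - 1 = q ^ n - 1" using q by (simp add: B_def)
      moreover have "q ^ 1 < q ^ n" using q n by (intro power_strict_increasing) auto
      ultimately show False using q by simp
    qed
  qed
qed

text \<open>\<open>um0_codegree n j\<close> is the number of common neighbours of two classes that are proportional
  modulo \<open>\<pi>\<^sup>j\<close> but not modulo \<open>\<pi>\<^sup>j\<^sup>+\<^sup>1\<close>; for \<open>j \<ge> l\<close> the classes are equal.\<close>

definition um0_base :: "nat \<Rightarrow> real" where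
  "um0_base n = real q ^ ((n - 3) * (l - 1)) * (real q ^ (n - 2) - 1) / (real q - 1)"

text \<open>Points of a hyperplane: (q^(n-1)-1)/(q-1) over the residue field, each with
  q^((n-2)(l-1)) lifts. \<open>um0_base\<close> is the same count in codimension two.\<close>

definition um0_degree :: "nat \<Rightarrow> real" where
  "um0_degree n = real q ^ ((n - 2) * (l - 1)) * (real q ^ (n - 1) - 1) / (real q - 1)"

definition um0_codegree :: "nat \<Rightarrow> nat \<Rightarrow> real" where
  "um0_codegree n j = (if j < l then real q ^ j * um0_base n else um0_degree n)"

text \<open>Differences of the codegree in the level: a pair of level \<open>j\<close> satisfies the
  relations 0, ..., j, so its coefficients telescope to the codegree.\<close>

definition um0_coeff :: "nat \<Rightarrow> nat \<Rightarrow> real" where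
  "um0_coeff n j = um0_codegree n j - (if j = 0 then 0 else um0_codegree n (j - 1))"

lemma sum_um0_coeff: "(\<Sum>i\<le>j. um0_coeff n i) = um0_codegree n j"
  by (induction j) (simp_all add: um0_coeff_def)

text \<open>Solutions with all entries in (\<pi>) are removed from all solutions. For
  \<open>j = l\<close> the exponent \<open>l - (j + 1)\<close> is truncated to 0, which is why equal
  classes need a separate formula.\<close>

lemma card_orthogonal_unimodular:
  assumes a: "a \<in> unimodular_vecs n" and b: "b \<in> unimodular_vecs n" and n: "3 \<le> n"
    and jl: "j \<le> l" and u: "scales n j u a b" and max: "j < l \<longrightarrow> \<not> vprop n (Suc j) a b"
  shows "real (card {z \<in> unimodular_vecs n. a \<bullet> z = 0 \<and> b \<bullet> z = 0}) =
    um0_codegree n j * (real q ^ (l - 1) * (real q - 1))"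
proof -
  obtain m where m: "n = m + 3" using n by (metis add.commute le_Suc_ex)
  define L where "L = l - 1"
  have L: "l = L + 1" using l_pos by (simp add: L_def)
  define k where "k e = card {x \<in> pi_vecs n e. a \<bullet> x = 0 \<and> b \<bullet> x = 0}" for e
  have k: "q ^ (l - e) * q ^ (l - (j + e)) * k e = q ^ ((l - e) * n)" for e
    unfolding k_def by (rule card_orthogonal_pi_vecs[OF a b jl u max])
  have "{z \<in> unimodular_vecs n. a \<bullet> z = 0 \<and> b \<bullet> z = 0} =
      {x \<in> pi_vecs n 0. a \<bullet> x = 0 \<and> b \<bullet> x = 0} - {x \<in> pi_vecs n 1. a \<bullet> x = 0 \<and> b \<bullet> x = 0}"
    unfolding unimodular_eq by (auto simp: pi_vecs_def)
  moreover have "{x \<in> pi_vecs n 1. a \<bullet> x = 0 \<and> b \<bullet> x = 0} \<subseteq> {x \<in> pi_vecs n 0. a \<bullet> x = 0 \<and> b \<bullet> x = 0}"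
    by (auto simp: pi_vecs_def)
  moreover have fin: "finite {x \<in> pi_vecs n e. a \<bullet> x = 0 \<and> b \<bullet> x = 0}" for e
    using finite_vecs(2) by (rule rev_finite_subset) auto
  ultimately have N: "real (card {z \<in> unimodular_vecs n. a \<bullet> z = 0 \<and> b \<bullet> z = 0}) = real (k 0) - real (k 1)"
    unfolding k_def by (simp add: card_Diff_subset card_mono of_nat_diff)
  have cancel: "x = y" if "q ^ c * x = q ^ c * y" for c x y :: nat using that q_ge_3 by simp
  have qr: "real q - 1 \<noteq> 0" using q_real by simp
  show ?thesis
  proof (cases "j < l")
    case True
    have "k 0 = q ^ ((m + 1) * l + j)"
    proof (rule cancel)
      have "l * n = l + (l - j) + ((m + 1) * l + j)" using True by (simp add: m algebra_simps)
      then show "q ^ (l + (l - j)) * k 0 = q ^ (l + (l - j)) * q ^ ((m + 1) * l + j)"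
        using k[of 0] by (simp only: power_add minus_nat.diff_0 add_0_right)
    qed
    moreover have "k 1 = q ^ ((m + 1) * L + j)"
    proof (rule cancel)
      have "L * n = L + (l - (j + 1)) + ((m + 1) * L + j)"
        using True by (simp add: m L algebra_simps)
      then show "q ^ (L + (l - (j + 1))) * k 1 = q ^ (L + (l - (j + 1))) * q ^ ((m + 1) * L + j)"
        using k[of 1] by (simp only: power_add L_def[symmetric])
    qed
    ultimately show ?thesis
      unfolding N using True qr
      by (simp add: um0_codegree_def um0_base_def L_def[symmetric] m)
         (simp add: L power_add algebra_simps)
  next
    case False
    then have jl: "j = l" using jl by simp
    have "k 0 = q ^ ((m + 2) * l)"
    proof (rule cancel)
      have "l * n = l + (m + 2) * l" by (simp add: m algebra_simps)
      then show "q ^ l * k 0 = q ^ l * q ^ ((m + 2) * l)"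
        using k[of 0] by (simp add: jl power_add)
    qed
    moreover have "k 1 = q ^ ((m + 2) * L)"
    proof (rule cancel)
      have "L * n = L + (m + 2) * L" by (simp add: m algebra_simps)
      then show "q ^ L * k 1 = q ^ L * q ^ ((m + 2) * L)"
        using k[of 1] by (simp add: jl power_add L_def)
    qed
    ultimately show ?thesis
      unfolding N using jl qr
      by (simp add: um0_codegree_def um0_degree_def L_def[symmetric] m)
         (simp add: L power_add algebra_simps)
  qed
qed

lemma um0_common_neighbours:
  assumes A: "A \<in> unimodular_vecs n // unit_scaling n" and B: "B \<in> unimodular_vecs n // unit_scaling n"
    and n: "3 \<le> n"
  shows "real (card {Z \<in> unimodular_vecs n // unit_scaling n. class_orth A Z \<and> class_orth B Z}) =
    (\<Sum>i\<le>l. if class_rel n i A B then um0_coeff n i else 0)"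
proof -
  obtain a where a: "a \<in> unimodular_vecs n" "A = unit_scaling n `` {a}" using A by (rule quotientE)
  obtain b where b: "b \<in> unimodular_vecs n" "B = unit_scaling n `` {b}" using B by (rule quotientE)
  obtain j where j: "j \<le> l" "\<And>i. i \<le> l \<Longrightarrow> vprop n i a b \<longleftrightarrow> i \<le> j"
    using ex_vprop_level[of n a b] by blast
  obtain u where u: "scales n j u a b" using j by (auto simp: vprop_def)
  have max: "j < l \<longrightarrow> \<not> vprop n (Suc j) a b" using j(2)[of "Suc j"] by auto
  let ?w = "real q ^ (l - 1) * (real q - 1)"
  have "{z \<in> unimodular_vecs n. class_orth A (unit_scaling n `` {z}) \<and> class_orth B (unit_scaling n `` {z})} =
      {z \<in> unimodular_vecs n. a \<bullet> z = 0 \<and> b \<bullet> z = 0}"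
    using a b by (auto simp: class_orth_iff)
  then have "card {Z \<in> unimodular_vecs n // unit_scaling n. class_orth A Z \<and> class_orth B Z} *
      (q ^ (l - 1) * (q - 1)) = card {z \<in> unimodular_vecs n. a \<bullet> z = 0 \<and> b \<bullet> z = 0}"
    using card_scaling_quotient[of n "\<lambda>Z. class_orth A Z \<and> class_orth B Z"] by simp
  from arg_cong[OF this, of real]
  have "real (card {Z \<in> unimodular_vecs n // unit_scaling n. class_orth A Z \<and> class_orth B Z}) * ?w =
      real (card {z \<in> unimodular_vecs n. a \<bullet> z = 0 \<and> b \<bullet> z = 0})"
    using q_ge_3 by (simp add: of_nat_diff)
  also have "\<dots> = um0_codegree n j * ?w"
    by (rule card_orthogonal_unimodular[OF a(1) b(1) n j(1) u max])
  finally have "real (card {Z \<in> unimodular_vecs n // unit_scaling n. class_orth A Z \<and> class_orth B Z}) =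
      um0_codegree n j"
    using q_real by simp
  also have "\<dots> = (\<Sum>i\<le>j. um0_coeff n i)" by (rule sum_um0_coeff[symmetric])
  also have "\<dots> = (\<Sum>i\<le>l. if i \<le> j then um0_coeff n i else 0)"
    using j(1) by (subst sum.inter_filter[symmetric]) (auto intro!: sum.cong)
  also have "\<dots> = (\<Sum>i\<le>l. if class_rel n i A B then um0_coeff n i else 0)"
    using a b j(2) by (intro sum.cong) (auto simp: class_rel_iff)
  finally show ?thesis .
qed

section \<open>Tail sums giving the squared eigenvalues of Um0\<close>

definition um0_ev :: "nat \<Rightarrow> nat \<Rightarrow> real" where
  "um0_ev n i = (\<Sum>k=i..l. um0_coeff n k * real (um0_size n k))"

lemma um0_ev_step: "i \<le> l \<Longrightarrow> um0_ev n i = um0_coeff n i * real (um0_size n i) + um0_ev n (Suc i)"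
  unfolding um0_ev_def by (rule sum.atLeast_Suc_atMost)

text \<open>Each step down multiplies the tail by q^(n-2): the new term is the old tail times
  q^(n-2) - 1.\<close>

lemma um0_ev_pos:
  assumes n: "3 \<le> n" and "0 < j" "j \<le> l"
  shows "um0_ev n j = real q ^ ((n - 2) * (2 * l - j))"
  using assms(3,2)
proof (induction rule: inc_induct)
  case base
  obtain m where m: "n = m + 3" using n by (metis add.commute le_Suc_ex)
  define L where "L = l - 1"
  have L: "l = L + 1" using l_pos by (simp add: L_def)
  have "um0_ev n l = um0_degree n - real q ^ L * um0_base n"
    using l_pos by (simp add: um0_ev_def um0_size_def um0_coeff_def um0_codegree_def L_def)
  \<comment> \<open>Both counts have denominator q - 1; clearing it leaves a polynomial
    identity.\<close>
  also have "\<dots> = real q ^ ((m + 1) * (L + 1))"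
  proof -
    have q1: "real q - 1 \<noteq> 0" using q_real by simp
    have "(um0_degree n - real q ^ L * um0_base n) * (real q - 1) =
        um0_degree n * (real q - 1) - real q ^ L * (um0_base n * (real q - 1))"
      by (simp add: algebra_simps)
    also have "\<dots> = real q ^ ((m + 1) * L) * (real q ^ (m + 2) - 1) -
        real q ^ L * (real q ^ (m * L) * (real q ^ (m + 1) - 1))"
      using q1 by (simp add: um0_degree_def um0_base_def L_def m)
    also have "\<dots> = real q ^ ((m + 1) * (L + 1)) * (real q - 1)"
      by (simp add: power_add algebra_simps)
    finally show ?thesis using q1 by simp
  qed
  finally show ?case by (simp add: m L)
next
  case (step j)
  obtain m where m: "n = m + 3" using n by (metis add.commute le_Suc_ex)
  obtain i where i: "j = Suc i" using step by (cases j) auto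
  obtain d where d: "l = j + Suc d" using step by (metis less_iff_Suc_add add_Suc_right)
  have "um0_coeff n j = (real q ^ j - real q ^ i) * um0_base n"
    using step by (simp add: um0_coeff_def um0_codegree_def i algebra_simps)
  also have "\<dots> = real q ^ i * real q ^ (m * (i + Suc d)) * (real q ^ (m + 1) - 1)"
  proof -
    have "l - 1 = i + Suc d" using d i by simp
    then have "um0_base n = real q ^ (m * (i + Suc d)) * (real q ^ (m + 1) - 1) / (real q - 1)"
      unfolding um0_base_def by (simp only:) (simp add: m)
    moreover have "real q ^ j - real q ^ i = real q ^ i * (real q - 1)" by (simp add: i algebra_simps)
    ultimately show ?thesis using q_real by (simp only:) simp
  qed
  finally have c: "um0_coeff n j = real q ^ i * real q ^ (m * (i + Suc d)) * (real q ^ (m + 1) - 1)" .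
  have s: "real (um0_size n j) = real q ^ (Suc d * (m + 2))"
  proof -
    have "real (um0_size n j) = real q ^ ((l - j) * (n - 1))" by (simp add: um0_size_def i)
    moreover have "l - j = Suc d" "n - 1 = m + 2" using d m by simp_all
    ultimately show ?thesis by (simp only:)
  qed
  have "um0_ev n (Suc j) = real q ^ ((m + 1) * (2 * l - Suc j))" using step by (simp add: m)
  also have "(m + 1) * (2 * l - Suc j) = i + m * (i + Suc d) + Suc d * (m + 2)"
    by (simp add: d i algebra_simps)
  finally have e: "um0_ev n (Suc j) = real q ^ (i + m * (i + Suc d) + Suc d * (m + 2))" .
  have "um0_ev n j = real q ^ (i + m * (i + Suc d) + Suc d * (m + 2) + (m + 1))"
    using um0_ev_step[of j n] step unfolding c s e by (simp add: power_add algebra_simps)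
  also have "i + m * (i + Suc d) + Suc d * (m + 2) + (m + 1) = (n - 2) * (2 * l - j)"
    by (simp add: d i m algebra_simps)
  finally show ?case .
qed

text \<open>With Q = q and t = q^(n-2), everything reduces to (t-1)(Q^2 t-1) + t(Q-1)^2 = (Qt-1)^2:
  the first product comes from the coefficient and size at 0, the second from the tail at 1.\<close>

lemma um0_ev_0:
  assumes n: "3 \<le> n"
  shows "um0_ev n 0 = (um0_degree n)\<^sup>2"
proof -
  obtain m where m: "n = m + 3" using n by (metis add.commute le_Suc_ex)
  define L where "L = l - 1"
  have L: "l = L + 1" using l_pos by (simp add: L_def)
  define Q t s where "Q = real q" and "t = real q ^ (m + 1)" and "s = real (um0_size n 0)"
  have Q: "Q - 1 \<noteq> 0" "Q > 0" using q_real by (auto simp: Q_def)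
  have "q ^ ((l - 1) * n) \<le> q ^ (l * n)" using q_ge_3 by (intro power_increasing) auto
  then have "s * (Q ^ L * (Q - 1)) = Q ^ (l * n) - Q ^ (L * n)"
    using arg_cong[OF card_quotient_unimodular[of n], of real] q_ge_3
    by (simp add: of_nat_diff s_def Q_def L_def)
  also have "\<dots> = Q ^ L * (Q ^ (L * (m + 2)) * (Q\<^sup>2 * t - 1))"
  proof -
    have "l * n = L + L * (m + 2) + 2 + (m + 1)" "L * n = L + L * (m + 2)"
      by (simp_all add: L m algebra_simps)
    then show ?thesis unfolding t_def Q_def[symmetric] by (simp only: power_add) (simp add: algebra_simps)
  qed
  finally have "Q ^ L * (s * (Q - 1)) = Q ^ L * (Q ^ (L * (m + 2)) * (Q\<^sup>2 * t - 1))" by (simp only: ac_simps)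
  then have s: "s * (Q - 1) = Q ^ (L * (m + 2)) * (Q\<^sup>2 * t - 1)" using Q by simp
  have base: "um0_base n * (Q - 1) = Q ^ (m * L) * (t - 1)"
    using Q by (simp add: um0_base_def Q_def t_def L_def m)
  have deg: "um0_degree n * (Q - 1) = t ^ L * (Q * t - 1)"
  proof -
    have "t ^ L = Q ^ ((m + 1) * L)" by (simp only: t_def Q_def power_mult)
    moreover have "um0_degree n * (Q - 1) = Q ^ ((m + 1) * L) * (Q ^ (m + 2) - 1)"
      using Q by (simp add: um0_degree_def Q_def L_def m)
    moreover have "Q ^ (m + 2) = Q * t" by (simp add: t_def Q_def)
    ultimately show ?thesis by (simp only:)
  qed
  have "um0_ev n 1 = t ^ (2 * L + 1)"
  proof -
    have "(n - 2) * (2 * l - 1) = (m + 1) * (2 * L + 1)" by (simp add: m L)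
    moreover have "um0_ev n 1 = real q ^ ((n - 2) * (2 * l - 1))"
      using um0_ev_pos[OF n, of 1] l_pos by simp
    ultimately show ?thesis by (simp only: t_def power_mult)
  qed
  then have "um0_ev n 0 = um0_base n * s + t ^ (2 * L + 1)"
    using um0_ev_step[of 0 n] l_pos by (simp add: um0_coeff_def um0_codegree_def s_def)
  then have "um0_ev n 0 * (Q - 1)\<^sup>2 =
      (um0_base n * (Q - 1)) * (s * (Q - 1)) + t ^ (2 * L + 1) * (Q - 1)\<^sup>2"
    by (simp add: algebra_simps power2_eq_square)
  also have "\<dots> = (Q ^ (m * L) * Q ^ (L * (m + 2))) * (t - 1) * (Q\<^sup>2 * t - 1) + t ^ (2 * L) * (t * (Q - 1)\<^sup>2)"
    unfolding base s by (simp add: algebra_simps)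
  also have "Q ^ (m * L) * Q ^ (L * (m + 2)) = t ^ (2 * L)"
  proof -
    have "m * L + L * (m + 2) = (m + 1) * (2 * L)" by (simp add: algebra_simps)
    then show ?thesis by (simp only: t_def Q_def[symmetric] power_mult[symmetric] power_add[symmetric])
  qed
  also have "t ^ (2 * L) * (t - 1) * (Q\<^sup>2 * t - 1) + t ^ (2 * L) * (t * (Q - 1)\<^sup>2) =
      (t ^ L * (Q * t - 1))\<^sup>2"
  proof -
    have "(t - 1) * (Q\<^sup>2 * t - 1) + t * (Q - 1)\<^sup>2 = (Q * t - 1)\<^sup>2"
      by (simp add: power2_eq_square algebra_simps)
    then have "t ^ (2 * L) * ((t - 1) * (Q\<^sup>2 * t - 1) + t * (Q - 1)\<^sup>2) = t ^ (2 * L) * (Q * t - 1)\<^sup>2"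
      by (simp only:)
    then show ?thesis
      by (simp add: power_mult_distrib distrib_left mult.assoc power_mult[symmetric] mult.commute[of L])
  qed
  also have "\<dots> = (um0_degree n)\<^sup>2 * (Q - 1)\<^sup>2" by (simp only: deg[symmetric] power_mult_distrib)
  finally show ?thesis using Q by simp
qed

lemma um0_ev_image:
  assumes n: "3 \<le> n"
  shows "um0_ev n ` {..l} = (\<lambda>r. r\<^sup>2) `
    ({real q ^ ((n - 2) * (l - 1)) * (real q ^ (n - 1) - 1) / (real q - 1)}
     \<union> {real q powr ((real n - 2) * (real l - real k / 2)) | k. k \<in> {1..l}})"
proof -
  have pos: "um0_ev n k = (real q powr ((real n - 2) * (real l - real k / 2)))\<^sup>2" if "k \<in> {1..l}" for k
  proof -
    have "real ((n - 2) * (2 * l - k)) = (real n - 2) * (2 * real l - real k)"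
      using n that by (simp only: of_nat_mult) (simp add: of_nat_diff)
    then have "2 * ((real n - 2) * (real l - real k / 2)) = real ((n - 2) * (2 * l - k))"
      by (simp only:) (simp add: field_simps)
    moreover have "um0_ev n k = real q ^ ((n - 2) * (2 * l - k))"
      using that by (intro um0_ev_pos[OF n]) auto
    ultimately show ?thesis using powr_square[OF q_real(1)] by metis
  qed
  have "um0_ev n ` {1..l} =
      (\<lambda>r. r\<^sup>2) ` {real q powr ((real n - 2) * (real l - real k / 2)) | k. k \<in> {1..l}}"
    unfolding Setcompr_eq_image image_image using pos by (rule image_cong[OF refl])
  moreover have "{..l} = insert 0 {1..l}" by auto
  ultimately show ?thesis
    using um0_ev_0[OF n] by (simp only: image_insert image_Un um0_degree_def image_empty insert_is_Un[symmetric])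
qed

lemma um0_eigenvalues:
  assumes n: "3 \<le> n"
  shows "adjacency_eigenvalues (Um0 n :: ('a vec set + 'a vec set) pair_pre_digraph) =
    plus_minus
      ({real q ^ ((n - 2) * (l - 1)) * (real q ^ (n - 1) - 1) / (real q - 1)}
       \<union> {real q powr ((real n - 2) * (real l - real k / 2)) | k. k \<in> {1..l}})"
    (is "_ = plus_minus ?S")
proof -
  interpret uniform_chain "unimodular_vecs n // unit_scaling n :: 'a vec set set" "class_rel n" l "um0_size n"
    by (rule um0_chain) (use n in simp)
  have Um0: "Um0 n = bipartite_graph (unimodular_vecs n // unit_scaling n)
      (unimodular_vecs n // unit_scaling n :: 'a vec set set) class_orth"
    unfolding Um0_def class_orth_def[abs_def] ..
  have "\<mu> \<in> adjacency_eigenvalues (Um0 n :: ('a vec set + 'a vec set) pair_pre_digraph) \<longleftrightarrow>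
      (\<exists>i\<le>l. \<mu>\<^sup>2 = of_real (um0_ev n i))" for \<mu>
  proof -
    have "class_orth A B = class_orth B A"
      if AB: "A \<in> unimodular_vecs n // unit_scaling n" "B \<in> unimodular_vecs n // unit_scaling n" for A B
    proof -
      obtain a where a: "a \<in> unimodular_vecs n" "A = unit_scaling n `` {a}" using AB(1) by (rule quotientE)
      obtain b where b: "b \<in> unimodular_vecs n" "B = unit_scaling n `` {b}" using AB(2) by (rule quotientE)
      show ?thesis
        using comm_scalar_prod[of a n b] a b by (simp add: class_orth_iff) (simp add: unimodular_vecs_def)
    qed
    from bipartite_graph_eigenvalues_iff[OF fin this] show ?thesis
      unfolding Um0 um0_ev_def
      by (subst kernel_eigenvalue_iff[symmetric]) (simp_all flip: um0_common_neighbours[OF _ _ n])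
  qed
  then have "adjacency_eigenvalues (Um0 n :: ('a vec set + 'a vec set) pair_pre_digraph) =
      {\<mu>. \<exists>t\<in>um0_ev n ` {..l}. \<mu>\<^sup>2 = of_real t}"
    by auto
  also have "\<dots> = plus_minus ?S"
    unfolding um0_ev_image[OF n] plus_minus_eq by blast
  finally show ?thesis .
qed

end

theorem theorem1p8:
  fixes \<pi> :: "'a::finite_valuation_ring" and q l :: nat
  assumes "is_maximal_ideal (ideal_generated {\<pi>})"
    and "q = quotient_ring_card (ideal_generated {\<pi>})"
    and "odd q"
    and "l = (LEAST j. 0 < j \<and> \<pi> ^ j = 0)"
  shows "(\<forall>n\<ge>2. adjacency_eigenvalues (Um n :: ('a vec + 'a vec) pair_pre_digraph) =
            plus_minus
              ({real q ^ ((n - 1) * l), real q powr ((real n - 1) * real l - real n / 2)}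
               \<union> {real q powr ((real n - 1) * (real l - real k / 2)) | k. k \<in> {1..l}})
            \<union> (if \<forall>x::'a. x \<noteq> 0 \<longrightarrow> x dvd 1 then {} else {0}))
       \<and> (\<forall>n\<ge>3. adjacency_eigenvalues (Um0 n :: ('a vec set + 'a vec set) pair_pre_digraph) =
            plus_minus
              ({real q ^ ((n - 2) * (l - 1)) * (real q ^ (n - 1) - 1) / (real q - 1)}
               \<union> {real q powr ((real n - 2) * (real l - real k / 2)) | k. k \<in> {1..l}}))"
proof -
  interpret uniformizer \<pi> q l
    using assms by unfold_locales
  show ?thesis using um_eigenvalues um0_eigenvalues by blast
qed

end
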